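(* Let $p\ge 11$ be prime, $1\le k<p$, let $H$ be a Sylow $p$-subgroup of $S_{pk}$, and let $\sigma\in S_{pk}$. Let $P$ be the transition kernel of the Sylow--Burnside process on $S_{pk}$ and $\pi$ its stationary distribution. If $|H\sigma H|=p^a$, then for all integers $t\ge 1$, $$\left|\Vert P^t_\sigma-\pi\Vert_{\mathrm{TV}}-1+\left(1-\left(1-\frac1p\right)^t\right)^{2k-a}\right|\le\frac{4p^4}{(p-1)!}+\frac{t}{(p-2)!}.$$ In particular, $$\Vert P^t_\sigma-\pi\Vert_{\mathrm{TV}}\le 1-\left(1-\left(1-\frac1p\right)^t\right)^{2k-a}+\frac{4p^4}{(p-1)!}+\frac{t}{(p-2)!}.$$
   Context: The group $H\times H$ acts on $S_{pk}$ by $\sigma^{h,g}=h^{-1}\sigma g$; the orbits are the double cosets $H\sigma H$, whose sizes lie in $\{p^k,p^{k+1},\dots,p^{2k}\}$. Let $(H\times H)_\sigma=\{(h,g):\sigma^{h,g}=\sigma\}$ and $S_{pk}^{h,g}=\{\tau\in S_{pk}:\tau^{h,g}=\tau\}$. The Sylow--Burnside process is the Markov chain on $S_{pk}$ with transition kernel $$P(\sigma,\tau)=\frac{1}{|(H\times H)_\sigma|}\sum_{(h,g)\in (H\times H)_\sigma\cap(H\times H)_\tau}\frac{1}{|S_{pk}^{h,g}|}.$$ Its unique stationary distribution is $\pi(\sigma)=\frac{1}{Z|H\sigma H|}$, where $Z$ is the number of double cosets $H\sigma H$ in $S_{pk}$. $P^t_\sigma$ denotes the distribution of the chain after $t$ steps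 started at $\sigma$. Total variation distance is $\Vert\mu-\nu\Vert_{\mathrm{TV}}=\frac12\sum_x|\mu(x)-\nu(x)|$. *)

theory Defs
  imports Complex_Main "HOL-Algebra.Sym_Groups" "HOL-Algebra.Group_Action"
    "HOL-Computational_Algebra.Primes"
begin

section \<open>Finite Markov chains\<close>

text \<open>
  A distribution on a finite set \<open>S\<close> is given by its mass function \<open>'a \<Rightarrow> real\<close>, a
  transition kernel by \<open>K :: 'a \<Rightarrow> 'a \<Rightarrow> real\<close>. Values outside \<open>S\<close> are irrelevant.
\<close>

primrec chain_dist :: "'a set \<Rightarrow> ('a \<Rightarrow> 'a \<Rightarrow> real) \<Rightarrow> 'a \<Rightarrow> nat \<Rightarrow> 'a \<Rightarrow> real"
  where
    "chain_dist S K x 0 = (\<lambda>y. if y = x then 1 else 0)"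
  | "chain_dist S K x (Suc t) = (\<lambda>y. \<Sum>z\<in>S. chain_dist S K x t z * K z y)"

definition stationary_distribution :: "'a set \<Rightarrow> ('a \<Rightarrow> 'a \<Rightarrow> real) \<Rightarrow> ('a \<Rightarrow> real) \<Rightarrow> bool"
  where "stationary_distribution S K \<mu> \<longleftrightarrow>
    (\<forall>x\<in>S. 0 \<le> \<mu> x) \<and> (\<Sum>x\<in>S. \<mu> x) = 1 \<and> (\<forall>y\<in>S. (\<Sum>x\<in>S. \<mu> x * K x y) = \<mu> y)"

definition tv_dist :: "'a set \<Rightarrow> ('a \<Rightarrow> real) \<Rightarrow> ('a \<Rightarrow> real) \<Rightarrow> real"
  where "tv_dist S \<mu> \<nu> = 1 / 2 * (\<Sum>x\<in>S. \<bar>\<mu> x - \<nu> x\<bar>)"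


section \<open>Sylow subgroups, double cosets and the Burnside process\<close>

definition sylow_subgroup :: "nat \<Rightarrow> 'a set \<Rightarrow> ('a, 'b) monoid_scheme \<Rightarrow> bool"
  where "sylow_subgroup p H G \<longleftrightarrow> subgroup H G \<and> card H = p ^ multiplicity p (order G)"

definition double_coset :: "('a, 'b) monoid_scheme \<Rightarrow> 'a set \<Rightarrow> 'a \<Rightarrow> 'a set"
  where "double_coset G H \<sigma> = (H #>\<^bsub>G\<^esub> \<sigma>) <#>\<^bsub>G\<^esub> H"

definition double_cosets :: "('a, 'b) monoid_scheme \<Rightarrow> 'a set \<Rightarrow> 'a set set"
  where "double_cosets G H = double_coset G H ` carrier G"

abbreviation square_group :: "('a, 'b) monoid_scheme \<Rightarrow> 'a set \<Rightarrow> ('a \<times> 'a) monoid"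
  where "square_group G H \<equiv> (G\<lparr>carrier := H\<rparr>) \<times>\<times> (G\<lparr>carrier := H\<rparr>)"

text \<open>
  This is a right action of \<open>H \<times> H\<close> on \<open>carrier G\<close>. It is therefore not an instance of the
  locale \<open>group_action\<close>, but the constants \<open>stabilizer\<close>, \<open>invariants\<close> and \<open>orbit\<close>
  make sense for it and have the intended meaning.
\<close>

definition two_sided_act :: "('a, 'b) monoid_scheme \<Rightarrow> 'a \<times> 'a \<Rightarrow> 'a \<Rightarrow> 'a"
  where "two_sided_act G = (\<lambda>(h, g) \<sigma>. inv\<^bsub>G\<^esub> h \<otimes>\<^bsub>G\<^esub> \<sigma> \<otimes>\<^bsub>G\<^esub> g)"

definition act_stabilizer :: "('a, 'b) monoid_scheme \<Rightarrow> 'a set \<Rightarrow> 'a \<Rightarrow> ('a \<times> 'a) set"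
  where "act_stabilizer G H \<sigma> = stabilizer (square_group G H) (two_sided_act G) \<sigma>"

definition burnside_kernel :: "('a, 'b) monoid_scheme \<Rightarrow> 'a set \<Rightarrow> 'a \<Rightarrow> 'a \<Rightarrow> real"
  where "burnside_kernel G H \<sigma> \<tau> =
    1 / real (card (act_stabilizer G H \<sigma>)) *
    (\<Sum>hg \<in> act_stabilizer G H \<sigma> \<inter> act_stabilizer G H \<tau>.
       1 / real (card (invariants (carrier G) (two_sided_act G) hg)))"


section \<open>The stationary distribution of the Burnside process\<close>

lemma stationary_distribution_unique:
  fixes K :: "'a \<Rightarrow> 'a \<Rightarrow> real"
  assumes fin: "finite S"
    and pos: "\<And>x y. x \<in> S \<Longrightarrow> y \<in> S \<Longrightarrow> 0 < K x y"
    and rows: "\<And>x. x \<in> S \<Longrightarrow> (\<Sum>y\<in>S. K x y) = 1"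
    and mu: "stationary_distribution S K \<mu>" and nu: "stationary_distribution S K \<nu>"
    and x: "x \<in> S"
  shows "\<mu> x = \<nu> x"
proof (rule ccontr)
  assume ne: "\<mu> x \<noteq> \<nu> x"
  define d where "d = (\<lambda>x. \<mu> x - \<nu> x)"
  have sum0: "(\<Sum>x\<in>S. d x) = 0"
    using mu nu by (simp add: d_def sum_subtractf stationary_distribution_def)
  have dK: "d y = (\<Sum>x\<in>S. d x * K x y)" if "y \<in> S" for y
    using mu nu that
    by (simp add: d_def sum_subtractf stationary_distribution_def left_diff_distrib)
  have "\<exists>u\<in>S. 0 < d u"
  proof (rule ccontr)
    assume "\<not> ?thesis"
    then have "\<forall>u\<in>S. 0 \<le> - d u" by force
    moreover have "(\<Sum>u\<in>S. - d u) = 0" using sum0 by (simp add: sum_negf)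
    ultimately have "\<forall>u\<in>S. - d u = 0" using fin by (simp add: sum_nonneg_eq_0_iff)
    then show False using x ne by (auto simp: d_def)
  qed
  then obtain u where u: "u \<in> S" "0 < d u" by blast
  have "\<exists>v\<in>S. d v < 0"
  proof (rule ccontr)
    assume "\<not> ?thesis"
    then have "\<forall>v\<in>S. 0 \<le> d v" by force
    then have "\<forall>v\<in>S. d v = 0" using fin sum0 by (simp add: sum_nonneg_eq_0_iff)
    then show False using x ne by (auto simp: d_def)
  qed
  then obtain v where v: "v \<in> S" "d v < 0" by blast
  have strict: "\<bar>d y\<bar> < (\<Sum>x\<in>S. \<bar>d x\<bar> * K x y)" if y: "y \<in> S" for y
  proof -
    have nonneg: "0 \<le> \<bar>d x\<bar> * K x y - d x * K x y" "0 \<le> \<bar>d x\<bar> * K x y + d x * K x y"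
      if "x \<in> S" for x
      using pos[OF that y]
      by (simp_all add: mult_right_mono flip: left_diff_distrib distrib_right)
    have "0 < (\<Sum>x\<in>S. \<bar>d x\<bar> * K x y - d x * K x y)"
      by (rule sum_pos2[OF fin v(1)])
         (use v pos[OF v(1) y] nonneg in \<open>auto simp: mult_less_0_iff\<close>)
    moreover have "0 < (\<Sum>x\<in>S. \<bar>d x\<bar> * K x y + d x * K x y)"
      by (rule sum_pos2[OF fin u(1)])
         (use u pos[OF u(1) y] nonneg in \<open>auto simp: mult_less_0_iff\<close>)
    ultimately show ?thesis
      using dK[OF y] by (simp add: sum_subtractf sum.distrib)
  qed
  have "(\<Sum>y\<in>S. \<bar>d y\<bar>) < (\<Sum>y\<in>S. \<Sum>x\<in>S. \<bar>d x\<bar> * K x y)"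
    by (rule sum_strict_mono) (use fin x strict in auto)
  also have "\<dots> = (\<Sum>x\<in>S. \<bar>d x\<bar> * (\<Sum>y\<in>S. K x y))"
    by (subst sum.swap) (simp add: sum_distrib_left)
  also have "\<dots> = (\<Sum>x\<in>S. \<bar>d x\<bar>)"
    by (simp add: rows)
  finally show False by simp
qed

context
  fixes G (structure) and H
  assumes grp: "group G" and sub: "subgroup H G" and fin: "finite (carrier G)"
begin

interpretation group G by (rule grp)

lemma subgroup_elem_carrier [simp]: "h \<in> H \<Longrightarrow> h \<in> carrier G"
  using sub subgroup.subset by blast

lemma finite_subgroup_carrier [simp]: "finite H"
  using sub fin subgroup.subset finite_subset by blast

lemma act_stabilizer_iff:
  "hg \<in> act_stabilizer G H \<sigma> \<longleftrightarrow>
     fst hg \<in> H \<and> snd hg \<in> H \<and> two_sided_act G hg \<sigma> = \<sigma>"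
  by (cases hg) (auto simp: act_stabilizer_def stabilizer_def DirProd_def)

lemma finite_act_stabilizer [simp]: "finite (act_stabilizer G H \<sigma>)"
  by (rule finite_subset[of _ "H \<times> H"]) (auto simp: act_stabilizer_iff)

lemma one_act_stabilizer: "\<sigma> \<in> carrier G \<Longrightarrow> (\<one>, \<one>) \<in> act_stabilizer G H \<sigma>"
  using sub by (simp add: act_stabilizer_iff two_sided_act_def subgroup.one_closed)

lemma double_coset_eq_image:
  "double_coset G H \<sigma> = (\<lambda>hg. two_sided_act G hg \<sigma>) ` (H \<times> H)"
proof (intro subset_antisym subsetI)
  fix \<tau> assume "\<tau> \<in> double_coset G H \<sigma>"
  then obtain h g where hg: "h \<in> H" "g \<in> H" "\<tau> = h \<otimes> \<sigma> \<otimes> g"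
    by (auto simp: double_coset_def set_mult_def r_coset_def)
  then have "\<tau> = two_sided_act G (inv h, g) \<sigma>"
    by (simp add: two_sided_act_def)
  then show "\<tau> \<in> (\<lambda>hg. two_sided_act G hg \<sigma>) ` (H \<times> H)"
    using hg sub by (auto intro!: image_eqI[of _ _ "(inv h, g)"] simp: subgroup.m_inv_closed)
next
  fix \<tau> assume "\<tau> \<in> (\<lambda>hg. two_sided_act G hg \<sigma>) ` (H \<times> H)"
  then obtain h g where "h \<in> H" "g \<in> H" "\<tau> = inv h \<otimes> \<sigma> \<otimes> g"
    by (auto simp: two_sided_act_def)
  moreover have "inv h \<in> H" if "h \<in> H" for h
    using that sub by (simp add: subgroup.m_inv_closed)
  ultimately show "\<tau> \<in> double_coset G H \<sigma>"
    by (auto simp: double_coset_def set_mult_def r_coset_def)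
qed

text \<open>The double coset of \<open>\<sigma>\<close> is the orbit of \<open>\<sigma>\<close>.\<close>

lemma double_coset_eq_orbit:
  "double_coset G H \<sigma> = orbit (square_group G H) (two_sided_act G) \<sigma>"
  by (auto simp: double_coset_eq_image orbit_def DirProd_def)

lemma double_coset_subset: "\<sigma> \<in> carrier G \<Longrightarrow> double_coset G H \<sigma> \<subseteq> carrier G"
  by (auto simp: double_coset_def set_mult_def r_coset_def)

lemma double_coset_self: "\<sigma> \<in> carrier G \<Longrightarrow> \<sigma> \<in> double_coset G H \<sigma>"
  using sub unfolding double_coset_eq_image
  by (auto intro!: image_eqI[of _ _ "(\<one>, \<one>)"] simp: two_sided_act_def subgroup.one_closed)

lemma double_coset_mono:
  assumes "\<sigma> \<in> carrier G" "\<tau> \<in> double_coset G H \<sigma>"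
  shows "double_coset G H \<tau> \<subseteq> double_coset G H \<sigma>"
proof
  fix \<rho> assume "\<rho> \<in> double_coset G H \<tau>"
  then obtain h g where 1: "h \<in> H" "g \<in> H" "\<rho> = h \<otimes> \<tau> \<otimes> g"
    by (auto simp: double_coset_def set_mult_def r_coset_def)
  obtain h' g' where 2: "h' \<in> H" "g' \<in> H" "\<tau> = h' \<otimes> \<sigma> \<otimes> g'"
    using assms by (auto simp: double_coset_def set_mult_def r_coset_def)
  have "\<rho> = (h \<otimes> h') \<otimes> \<sigma> \<otimes> (g' \<otimes> g)"
    using 1 2 assms by (simp add: m_assoc)
  moreover have "h \<otimes> h' \<in> H" "g' \<otimes> g \<in> H"
    using 1 2 sub by (simp_all add: subgroup.m_closed)
  ultimately show "\<rho> \<in> double_coset G H \<sigma>"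
    by (auto simp: double_coset_def set_mult_def r_coset_def)
qed

lemma double_coset_sym:
  assumes "\<sigma> \<in> carrier G" "\<tau> \<in> double_coset G H \<sigma>"
  shows "\<sigma> \<in> double_coset G H \<tau>"
proof -
  obtain h g where 2: "h \<in> H" "g \<in> H" "\<tau> = h \<otimes> \<sigma> \<otimes> g"
    using assms by (auto simp: double_coset_def set_mult_def r_coset_def)
  have "\<sigma> = inv h \<otimes> \<tau> \<otimes> inv g"
    using 2 assms by (simp add: m_assoc) (simp flip: m_assoc)
  moreover have "inv h \<in> H" "inv g \<in> H"
    using 2 sub by (simp_all add: subgroup.m_inv_closed)
  ultimately show ?thesis
    by (auto simp: double_coset_def set_mult_def r_coset_def)
qed

lemma double_coset_eq_iff:
  assumes "\<sigma> \<in> carrier G" "\<tau> \<in> carrier G"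
  shows "double_coset G H \<tau> = double_coset G H \<sigma> \<longleftrightarrow> \<tau> \<in> double_coset G H \<sigma>"
  using assms double_coset_self double_coset_mono double_coset_sym by (metis subset_antisym)

lemma orbit_stabilizer_card:
  assumes s: "\<sigma> \<in> carrier G"
  shows "card (double_coset G H \<sigma>) * card (act_stabilizer G H \<sigma>) = card H * card H"
proof -
  let ?f = "\<lambda>hg. two_sided_act G hg \<sigma>"
  have fib: "card {hg \<in> H \<times> H. ?f hg = \<tau>} = card (act_stabilizer G H \<sigma>)"
    if t: "\<tau> \<in> ?f ` (H \<times> H)" for \<tau>
  proof -
    obtain h0 g0 where 0: "h0 \<in> H" "g0 \<in> H" "\<tau> = inv h0 \<otimes> \<sigma> \<otimes> g0"
      using t by (auto simp: two_sided_act_def)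
    have inv0: "inv h0 \<in> H" "inv g0 \<in> H"
      using 0 sub by (simp_all add: subgroup.m_inv_closed)
    have cl: "a \<otimes> b \<in> H" if "a \<in> H" "b \<in> H" for a b
      using that sub by (simp add: subgroup.m_closed)
    have A: "inv (h \<otimes> h0) \<otimes> \<sigma> \<otimes> (g \<otimes> g0) = inv h0 \<otimes> (inv h \<otimes> \<sigma> \<otimes> g) \<otimes> g0"
      if "h \<in> H" "g \<in> H" for h g
      using that 0 s by (simp add: inv_mult_group m_assoc)
    have B: "inv (h \<otimes> inv h0) \<otimes> \<sigma> \<otimes> (g \<otimes> inv g0) = h0 \<otimes> (inv h \<otimes> \<sigma> \<otimes> g) \<otimes> inv g0"
      if "h \<in> H" "g \<in> H" for h g
      using that 0 s by (simp add: inv_mult_group m_assoc)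
    have C: "h0 \<otimes> (inv h0 \<otimes> \<sigma> \<otimes> g0) \<otimes> inv g0 = \<sigma>"
      using 0 s by (simp add: m_assoc) (simp flip: m_assoc)
    have E: "h0 \<otimes> (inv h \<otimes> \<sigma> \<otimes> g) \<otimes> inv g0 = \<sigma>"
      if "inv h0 \<otimes> \<sigma> \<otimes> g0 = inv h \<otimes> \<sigma> \<otimes> g" for h g
      using C by (simp only: that)
    have D: "a \<otimes> b \<otimes> inv b = a" "a \<otimes> inv b \<otimes> b = a" if "a \<in> H" "b \<in> H" for a b
      using that by (simp_all add: m_assoc)
    have "bij_betw (\<lambda>(h, g). (h \<otimes> h0, g \<otimes> g0)) (act_stabilizer G H \<sigma>)
            {hg \<in> H \<times> H. ?f hg = \<tau>}"
      by (rule bij_betw_byWitness[where f' = "\<lambda>(h, g). (h \<otimes> inv h0, g \<otimes> inv g0)"])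
         (auto simp: act_stabilizer_iff two_sided_act_def A B C D 0(1,2) cl inv0
           simp flip: 0(3), simp_all add: 0(3) A B E)
    then show ?thesis by (simp add: bij_betw_same_card)
  qed
  have "card (H \<times> H) = (\<Sum>hg\<in>H \<times> H. 1)" by simp
  also have "\<dots> = (\<Sum>\<tau>\<in>?f ` (H \<times> H). \<Sum>hg\<in>{hg \<in> H \<times> H. ?f hg = \<tau>}. 1)"
    by (rule sum.image_gen) simp
  also have "\<dots> = (\<Sum>\<tau>\<in>?f ` (H \<times> H). card (act_stabilizer G H \<sigma>))"
    using fib by simp
  finally show ?thesis
    by (simp add: double_coset_eq_image)
qed

lemma invariants_pos:
  assumes "\<sigma> \<in> carrier G" "hg \<in> act_stabilizer G H \<sigma>"
  shows "0 < card (invariants (carrier G) (two_sided_act G) hg)"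
proof -
  have "\<sigma> \<in> invariants (carrier G) (two_sided_act G) hg"
    using assms by (simp add: invariants_def act_stabilizer_iff)
  moreover have "finite (invariants (carrier G) (two_sided_act G) hg)"
    using fin by (simp add: invariants_def)
  ultimately show ?thesis by (auto simp: card_gt_0_iff)
qed

lemma act_stabilizer_pos: "\<sigma> \<in> carrier G \<Longrightarrow> 0 < card (act_stabilizer G H \<sigma>)"
  using one_act_stabilizer by (auto simp: card_gt_0_iff)

lemma burnside_kernel_pos:
  assumes "\<sigma> \<in> carrier G" "\<tau> \<in> carrier G"
  shows "0 < burnside_kernel G H \<sigma> \<tau>"
  unfolding burnside_kernel_def
  by (intro mult_pos_pos sum_pos2[of _ "(\<one>, \<one>)"])
     (use assms one_act_stabilizer act_stabilizer_pos invariants_pos in auto)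

lemma burnside_kernel_row_sum:
  assumes s: "\<sigma> \<in> carrier G"
  shows "(\<Sum>\<tau>\<in>carrier G. burnside_kernel G H \<sigma> \<tau>) = 1"
proof -
  let ?A = "act_stabilizer G H \<sigma>"
  let ?I = "invariants (carrier G) (two_sided_act G)"
  have inner: "(\<Sum>\<tau>\<in>carrier G. if hg \<in> act_stabilizer G H \<tau> then 1 / real (card (?I hg)) else 0) = 1"
    if hg: "hg \<in> ?A" for hg
  proof -
    have "{\<tau> \<in> carrier G. hg \<in> act_stabilizer G H \<tau>} = ?I hg"
      using hg by (auto simp: act_stabilizer_iff invariants_def)
    moreover have "(\<Sum>\<tau>\<in>carrier G. if hg \<in> act_stabilizer G H \<tau> then 1 / real (card (?I hg)) else 0)
       = (\<Sum>\<tau>\<in>{\<tau> \<in> carrier G. hg \<in> act_stabilizer G H \<tau>}. 1 / real (card (?I hg)))"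
      by (rule sum.inter_filter[symmetric, OF fin])
    ultimately show ?thesis using invariants_pos[OF s hg] by simp
  qed
  have "(\<Sum>\<tau>\<in>carrier G. burnside_kernel G H \<sigma> \<tau>) = 1 / real (card ?A) *
     (\<Sum>\<tau>\<in>carrier G. \<Sum>hg\<in>?A. if hg \<in> act_stabilizer G H \<tau> then 1 / real (card (?I hg)) else 0)"
    by (simp add: burnside_kernel_def sum_distrib_left sum.inter_restrict)
  also have "\<dots> = 1 / real (card ?A) *
     (\<Sum>hg\<in>?A. \<Sum>\<tau>\<in>carrier G. if hg \<in> act_stabilizer G H \<tau> then 1 / real (card (?I hg)) else 0)"
    by (subst sum.swap) simp
  also have "\<dots> = 1"
    using inner act_stabilizer_pos[OF s] by auto
  finally show ?thesis .
qed

lemma sum_inverse_card_double_coset: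
  "(\<Sum>\<sigma>\<in>carrier G. 1 / real (card (double_coset G H \<sigma>))) = real (card (double_cosets G H))"
proof -
  have "(\<Sum>\<sigma>\<in>carrier G. 1 / real (card (double_coset G H \<sigma>))) =
    (\<Sum>C\<in>double_cosets G H. \<Sum>\<sigma>\<in>{\<sigma> \<in> carrier G. double_coset G H \<sigma> = C}. 1 / real (card (double_coset G H \<sigma>)))"
    unfolding double_cosets_def by (rule sum.image_gen[OF fin])
  also have "\<dots> = (\<Sum>C\<in>double_cosets G H. 1)"
  proof (rule sum.cong[OF refl])
    fix C assume "C \<in> double_cosets G H"
    then obtain \<tau> where t: "\<tau> \<in> carrier G" "C = double_coset G H \<tau>"
      by (auto simp: double_cosets_def)
    have *: "{\<sigma> \<in> carrier G. double_coset G H \<sigma> = C} = C"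
      using double_coset_eq_iff[OF t(1)] double_coset_subset[OF t(1)] t(2) by auto
    have "C \<noteq> {}" "finite C"
      using double_coset_self[OF t(1)] finite_subset[OF double_coset_subset[OF t(1)] fin] t(2)
      by auto
    then have "0 < card C" by (simp add: card_gt_0_iff)
    moreover have "(\<Sum>\<sigma>\<in>{\<sigma> \<in> carrier G. double_coset G H \<sigma> = C}. 1 / real (card (double_coset G H \<sigma>)))
      = (\<Sum>\<sigma>\<in>{\<sigma> \<in> carrier G. double_coset G H \<sigma> = C}. 1 / real (card C))"
      by (rule sum.cong) auto
    ultimately show "(\<Sum>\<sigma>\<in>{\<sigma> \<in> carrier G. double_coset G H \<sigma> = C}. 1 / real (card (double_coset G H \<sigma>))) = 1"
      by (simp add: *)
  qed
  finally show ?thesis by simp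
qed

lemma double_cosets_pos: "0 < card (double_cosets G H)"
  using fin one_closed by (auto simp: card_gt_0_iff double_cosets_def)

lemma burnside_kernel_stationary:
  "stationary_distribution (carrier G) (burnside_kernel G H)
     (\<lambda>\<sigma>. 1 / (real (card (double_cosets G H)) * real (card (double_coset G H \<sigma>))))"
proof -
  let ?Z = "real (card (double_cosets G H))"
  let ?q = "\<lambda>\<sigma>. 1 / (?Z * real (card (double_coset G H \<sigma>)))"
  let ?K = "burnside_kernel G H"
  let ?c = "\<lambda>\<sigma>. real (card (act_stabilizer G H \<sigma>))"
  have Hpos: "0 < real (card H)"
    using sub subgroup.one_closed by (fastforce simp: card_gt_0_iff)
  have q: "?q \<sigma> = ?c \<sigma> / (?Z * (real (card H) * real (card H)))" if s: "\<sigma> \<in> carrier G" for \<sigma>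
  proof -
    have "real (card H) * real (card H) = real (card (double_coset G H \<sigma>)) * ?c \<sigma>"
      using orbit_stabilizer_card[OF s] by (simp flip: of_nat_mult)
    then show ?thesis using act_stabilizer_pos[OF s] by auto
  qed
  have ck: "?c \<sigma> * ?K \<sigma> \<tau> = ?c \<tau> * ?K \<tau> \<sigma>" if "\<sigma> \<in> carrier G" "\<tau> \<in> carrier G" for \<sigma> \<tau>
    using act_stabilizer_pos[OF that(1)] act_stabilizer_pos[OF that(2)]
    by (simp add: burnside_kernel_def Int_commute)
  have rev: "?q \<sigma> * ?K \<sigma> \<tau> = ?q \<tau> * ?K \<tau> \<sigma>" if "\<sigma> \<in> carrier G" "\<tau> \<in> carrier G" for \<sigma> \<tau>
    by (simp only: q[OF that(1)] q[OF that(2)] times_divide_eq_left ck[OF that])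
  have "(\<Sum>\<sigma>\<in>carrier G. ?q \<sigma> * ?K \<sigma> \<tau>) = ?q \<tau>" if t: "\<tau> \<in> carrier G" for \<tau>
  proof -
    have "(\<Sum>\<sigma>\<in>carrier G. ?q \<sigma> * ?K \<sigma> \<tau>) = (\<Sum>\<sigma>\<in>carrier G. ?q \<tau> * ?K \<tau> \<sigma>)"
      using rev t by (intro sum.cong) auto
    also have "\<dots> = ?q \<tau>"
      by (simp only: sum_distrib_left[symmetric] burnside_kernel_row_sum[OF t] mult_1_right)
    finally show ?thesis .
  qed
  moreover have "(\<Sum>\<sigma>\<in>carrier G. ?q \<sigma>) = 1"
  proof -
    have "(\<Sum>\<sigma>\<in>carrier G. ?q \<sigma>) = 1 / ?Z * (\<Sum>\<sigma>\<in>carrier G. 1 / real (card (double_coset G H \<sigma>)))"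
      by (simp add: sum_distrib_left)
    then show ?thesis
      using double_cosets_pos by (simp only: sum_inverse_card_double_coset) simp
  qed
  ultimately show ?thesis by (simp add: stationary_distribution_def)
qed

text \<open>
  Existence, uniqueness and the closed formula \<open>\<pi>(\<sigma>) = 1 / (Z |H\<sigma>H|)\<close>, where \<open>Z\<close> is the
  number of double cosets.
\<close>

theorem burnside_stationary_iff:
  "stationary_distribution (carrier G) (burnside_kernel G H) \<mu> \<longleftrightarrow>
     (\<forall>\<sigma>\<in>carrier G. \<mu> \<sigma> =
        1 / (real (card (double_cosets G H)) * real (card (double_coset G H \<sigma>))))"
  (is "?L \<longleftrightarrow> ?R")
proof
  assume ?L
  then show ?R
    using stationary_distribution_unique[OF fin burnside_kernel_pos burnside_kernel_row_sum
        _ burnside_kernel_stationary]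
    by blast
next
  assume R: ?R
  have "stationary_distribution (carrier G) (burnside_kernel G H) \<mu> \<longleftrightarrow>
    stationary_distribution (carrier G) (burnside_kernel G H)
     (\<lambda>\<sigma>. 1 / (real (card (double_cosets G H)) * real (card (double_coset G H \<sigma>))))"
    unfolding stationary_distribution_def using R by (intro arg_cong2[of _ _ _ _ conj] ball_cong arg_cong2[of _ _ _ _ "(=)"] sum.cong) auto
  then show ?L using burnside_kernel_stationary by simp
qed

end

declare subgroup_elem_carrier [simp del] finite_subgroup_carrier [simp del] finite_act_stabilizer [simp del]

end

theory Submission
  imports Defs "HOL-Library.FuncSet"
begin

text \<open>
  Since \<open>k < p\<close>, the group \<open>H\<close> is a direct product of \<open>k\<close> cyclic groups of order \<open>p\<close>, each
  acting transitively on one of the \<open>k\<close> orbits (blocks) of \<open>H\<close> and trivially on the others.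
  The intersection of \<open>H\<close> with \<open>\<sigma> H \<sigma>\<^sup>-\<^sup>1\<close> is the subproduct over a set of \<open>m(\<sigma>)\<close> blocks, so
  \<open>card (H \<sigma> H) = p\<^bsup>2k - m(\<sigma>)\<^esup>\<close>. One step of the chain picks a uniform \<open>h\<close> in this
  subproduct, so each of the \<open>m(\<sigma>)\<close> blocks is retained independently with probability
  \<open>s = 1 - 1/p\<close>, and then a uniform \<open>\<tau>\<close> that conjugates \<open>h\<close> in the same way as \<open>\<sigma>\<close>; the expected
  number of blocks gained by \<open>\<tau>\<close> is at most \<open>\<delta> = 1/(p - 2)!\<close>. Up to an error of \<open>\<delta>\<close> per
  step, \<open>m\<close> is a pure death process, so the probability that it has died out by time \<open>t\<close> is
  \<open>(1 - s\<^sup>t)\<^bsup>m(\<sigma>)\<^esup>\<close>. Stationarity bounds the mean of \<open>m\<close> under \<open>\<pi>\<close> by \<open>p \<delta>\<close>; as \<open>\<pi>\<close> is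
  constant on \<open>m = 0\<close>, it is within \<open>p \<delta>\<close> of the uniform distribution, which is exactly what
  the chain samples when it picks \<open>h = 1\<close>.
\<close>

section \<open>Permutation groups\<close>

lemma subgroup_sym_group_iff:
  "subgroup K (sym_group n) \<longleftrightarrow>
     (\<forall>f\<in>K. f permutes {1..n} \<and> inv' f \<in> K) \<and> id \<in> K \<and> (\<forall>f\<in>K. \<forall>g\<in>K. f \<circ> g \<in> K)"
proof
  assume K: "subgroup K (sym_group n)"
  have car: "f \<in> carrier (sym_group n)" if "f \<in> K" for f
    using K that subgroup.subset by blast
  show "(\<forall>f\<in>K. f permutes {1..n} \<and> inv' f \<in> K) \<and> id \<in> K \<and> (\<forall>f\<in>K. \<forall>g\<in>K. f \<circ> g \<in> K)"
  proof (intro conjI ballI)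
    fix f assume "f \<in> K"
    then show "f permutes {1..n}" "inv' f \<in> K"
      using car[of f] subgroup.m_inv_closed[OF K, of f] by (simp_all add: sym_group_carrier)
  next
    show "id \<in> K" using subgroup.one_closed[OF K] by (simp add: sym_group_one)
  next
    fix f g assume "f \<in> K" "g \<in> K"
    then show "f \<circ> g \<in> K"
      using subgroup.m_closed[OF K, of f g] by (simp add: sym_group_mult)
  qed
next
  assume K: "(\<forall>f\<in>K. f permutes {1..n} \<and> inv' f \<in> K) \<and> id \<in> K \<and> (\<forall>f\<in>K. \<forall>g\<in>K. f \<circ> g \<in> K)"
  show "subgroup K (sym_group n)"
  proof (rule group.subgroupI[OF sym_group_is_group])
    show "K \<subseteq> carrier (sym_group n)"
      using K by (auto simp: sym_group_carrier)
    fix f assume "f \<in> K"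
    then show "inv\<^bsub>sym_group n\<^esub> f \<in> K"
      using K by (subst sym_group_inv_equality) (auto simp: sym_group_carrier)
  qed (use K in \<open>auto simp: sym_group_mult\<close>)
qed

text \<open>Every nonempty fibre of evaluation at \<open>x\<close> is a left translate of the
  stabilizer of \<open>x\<close> in \<open>K\<close>, so all of them have the same size.\<close>

lemma card_orbit_mult_card_fixing:
  assumes K: "subgroup K (sym_group n)"
  shows "card ((\<lambda>f. f x) ` K) * card {f \<in> K. f x = x} = card K"
proof -
  have perm: "f permutes {1..n}" "inv' f \<in> K" if "f \<in> K" for f
    using K that by (auto simp: subgroup_sym_group_iff)
  have comp: "f \<circ> g \<in> K" if "f \<in> K" "g \<in> K" for f g
    using K that by (auto simp: subgroup_sym_group_iff)
  have fin: "finite K"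
    by (rule finite_subset[OF _ finite_permutations[of "{1..n}"]]) (use perm(1) in auto)
  have fibre: "card {f \<in> K. f x = y} = card {f \<in> K. f x = x}" if "y \<in> (\<lambda>f. f x) ` K" for y
  proof -
    obtain g where g: "g \<in> K" "y = g x" using \<open>y \<in> _\<close> by auto
    have inv_g: "inv' g (g z) = z" "g (inv' g z) = z" for z
      using permutes_inverses[OF perm(1)[OF g(1)]] by auto
    have inv_g': "inv' g \<circ> (g \<circ> f) = f" "g \<circ> (inv' g \<circ> f) = f" for f
      by (simp_all add: fun_eq_iff inv_g)
    have "bij_betw ((\<circ>) g) {f \<in> K. f x = x} {f \<in> K. f x = y}"
    proof (rule bij_betw_byWitness[where f' = "(\<circ>) (inv' g)"])
      show "(\<circ>) g ` {f \<in> K. f x = x} \<subseteq> {f \<in> K. f x = y}"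
        using comp[OF g(1)] g(2) by auto
      show "(\<circ>) (inv' g) ` {f \<in> K. f x = y} \<subseteq> {f \<in> K. f x = x}"
        using comp[OF perm(2)[OF g(1)]] g(2) inv_g by auto
    qed (simp_all only: inv_g' Ball_def, simp_all)
    then show ?thesis by (simp add: bij_betw_same_card)
  qed
  have "card K = (\<Sum>f\<in>K. 1)" by simp
  also have "\<dots> = (\<Sum>y\<in>(\<lambda>f. f x) ` K. \<Sum>f\<in>{f \<in> K. f x = y}. 1)"
    by (rule sum.image_gen[OF fin])
  also have "\<dots> = (\<Sum>y\<in>(\<lambda>f. f x) ` K. card {f \<in> K. f x = x})"
    using fibre by simp
  finally show ?thesis by simp
qed

lemma (in group) card_subgroup_dvd_card_subgroup:
  assumes "subgroup K G" "subgroup H G" "K \<subseteq> H"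
  shows "card K dvd card H"
proof -
  interpret GH: group "G\<lparr>carrier := H\<rparr>" by (rule subgroup_imp_group[OF assms(2)])
  have "subgroup K (G\<lparr>carrier := H\<rparr>)" by (rule subgroup_incl[OF assms])
  from GH.lagrange[OF this] have "card H = card (rcosets\<^bsub>G\<lparr>carrier := H\<rparr>\<^esub> K) * card K"
    by (simp add: order_def)
  then show ?thesis by simp
qed

text \<open>Below \<open>p * p\<close> a positive multiple of \<open>p\<close> contains the factor
  \<open>p\<close> exactly once, so only the first term of Legendre's formula remains.\<close>

lemma multiplicity_fact_less_square:
  assumes p: "prime (p::nat)" and "n < p * p"
  shows "multiplicity p (fact n :: nat) = n div p"
  using assms(2)
proof (induction n)
  case 0
  then show ?case by simp
next
  case (Suc n)
  have "multiplicity p (Suc n) = (if p dvd Suc n then 1 else 0)"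
  proof (cases "p dvd Suc n")
    case True
    have "\<not> p ^ Suc 1 dvd Suc n"
      using Suc.prems by (auto dest: dvd_imp_le)
    with True show ?thesis by (intro multiplicity_eqI) auto
  qed (simp add: not_dvd_imp_multiplicity_0)
  moreover have "Suc n div p = (if p dvd Suc n then 1 else 0) + n div p"
    by (simp add: div_Suc dvd_eq_mod_eq_0)
  moreover have "fact (Suc n) = Suc n * (fact n :: nat)" by simp
  ultimately show ?case
    using Suc p by (simp add: prime_elem_multiplicity_mult_distrib del: fact_Suc mult_Suc)
qed

section \<open>The block structure of a Sylow subgroup\<close>

text \<open>The Sylow property is recorded as \<open>card H = p ^ k\<close>: for
  \<open>k < p\<close> this is the exact power of \<open>p\<close> dividing the factorial of
  \<open>p * k\<close>.\<close>

locale sylow_perm_group =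
  fixes p k :: nat and H :: "(nat \<Rightarrow> nat) set"
  assumes prime_p: "prime p" and k_less: "k < p"
    and subgroup_H: "subgroup H (sym_group (p * k))"
    and card_H: "card H = p ^ k"
begin

section \<open>Orbits of \<open>H\<close> and their sizes\<close>

definition \<Omega> :: "nat set" where "\<Omega> = {1..p * k}"

abbreviation G :: "(nat \<Rightarrow> nat) monoid" where "G \<equiv> sym_group (p * k)"

definition blk :: "nat \<Rightarrow> nat set" where "blk x = (\<lambda>h. h x) ` H"

definition blocks :: "nat set set" where "blocks = blk ` \<Omega>"

definition rep :: "nat set \<Rightarrow> nat" where "rep B = (SOME x. x \<in> B)"

lemma finite_\<Omega> [simp]: "finite \<Omega>"
  and card_\<Omega>: "card \<Omega> = p * k"
  by (simp_all add: \<Omega>_def)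

lemma carrier_G: "f \<in> carrier G \<longleftrightarrow> f permutes \<Omega>"
  by (simp only: sym_group_carrier \<Omega>_def)

lemma subgroup_G_iff:
  "subgroup K G \<longleftrightarrow>
     (\<forall>f\<in>K. f permutes \<Omega> \<and> inv' f \<in> K) \<and> id \<in> K \<and> (\<forall>f\<in>K. \<forall>g\<in>K. f \<circ> g \<in> K)"
  by (simp only: subgroup_sym_group_iff \<Omega>_def)

lemma p_gt_1: "1 < p"
  using prime_p by (rule prime_gt_1_nat)

lemma H_permutes: "h \<in> H \<Longrightarrow> h permutes \<Omega>"
  and H_inv: "h \<in> H \<Longrightarrow> inv' h \<in> H"
  and H_id: "id \<in> H"
  and H_comp: "h \<in> H \<Longrightarrow> g \<in> H \<Longrightarrow> h \<circ> g \<in> H"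
  using subgroup_H[unfolded subgroup_G_iff] by simp_all

lemma finite_H: "finite H"
  using card_H p_gt_1 by (intro card_ge_0_finite) simp

lemma H_inverses: "h \<in> H \<Longrightarrow> inv' h (h x) = x" "h \<in> H \<Longrightarrow> h (inv' h x) = x"
  by (simp_all add: permutes_inverses[OF H_permutes])

lemma H_closed: "h \<in> H \<Longrightarrow> x \<in> \<Omega> \<Longrightarrow> h x \<in> \<Omega>"
  by (simp only: permutes_in_image[OF H_permutes])

lemma blkI: "h \<in> H \<Longrightarrow> h x \<in> blk x"
  using imageI[of h H "\<lambda>h. h x"] by (simp add: blk_def)

lemma blkE: assumes "y \<in> blk x" obtains h where "h \<in> H" "y = h x"
  using assms unfolding blk_def by (elim imageE) simp

lemma blk_self: "x \<in> blk x"
  using blkI[OF H_id] by simp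

lemma blk_subset: "x \<in> \<Omega> \<Longrightarrow> blk x \<subseteq> \<Omega>"
  using H_closed by (blast elim: blkE)

lemma finite_blk: "finite (blk x)"
  by (simp add: blk_def finite_H)

lemma blk_eq: assumes "y \<in> blk x" shows "blk y = blk x"
proof -
  obtain h where h: "h \<in> H" "y = h x" using assms by (rule blkE)
  show ?thesis
  proof (intro subset_antisym subsetI)
    fix z assume "z \<in> blk y"
    then obtain g where "g \<in> H" "z = g y" by (rule blkE)
    then show "z \<in> blk x" using blkI[OF H_comp, of g h x] h by simp
  next
    fix z assume "z \<in> blk x"
    then obtain g where "g \<in> H" "z = g x" by (rule blkE)
    then show "z \<in> blk y" using blkI[OF H_comp[OF _ H_inv[OF h(1)]], of g y] h H_inverses by simp
  qed
qed

text \<open>Orbit sizes are powers of \<open>p\<close> and at most \<open>p k < p\<^sup>2\<close>.\<close>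

lemma card_orbit_cases:
  assumes K: "subgroup K G" "K \<subseteq> H" and x: "x \<in> \<Omega>"
  shows "card ((\<lambda>h. h x) ` K) = 1 \<or> card ((\<lambda>h. h x) ` K) = p"
proof -
  let ?c = "card ((\<lambda>h. h x) ` K)"
  have "?c dvd card K"
    by (rule dvdI[OF card_orbit_mult_card_fixing[OF K(1), symmetric]])
  also have "card K dvd p ^ k"
    using group.card_subgroup_dvd_card_subgroup[OF sym_group_is_group K(1) subgroup_H K(2)]
    by (simp add: card_H)
  finally obtain i where i: "?c = p ^ i"
    using prime_p divides_primepow_nat by blast
  have "(\<lambda>h. h x) ` K \<subseteq> \<Omega>"
    using K(2) H_closed[OF _ x] by (intro image_subsetI) blast
  then have "?c \<le> card \<Omega>" by (intro card_mono) auto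
  also have "card \<Omega> < p ^ 2"
    using k_less p_gt_1 by (simp add: card_\<Omega> power2_eq_square)
  finally have "i < 2"
    using i p_gt_1 by simp
  then show ?thesis using i by (auto simp: less_2_cases_iff)
qed

lemma subgroup_fixing: "subgroup {h \<in> H. h x = x} G"
proof -
  have "inv' h x = x" if "h \<in> H" "h x = x" for h
    using H_inverses(1)[OF that(1), of x] that(2) by simp
  then show ?thesis
    unfolding subgroup_G_iff
    by (intro conjI ballI CollectI H_permutes H_inv H_id H_comp) simp_all
qed

text \<open>The stabilizer of \<open>x\<close> permutes the fewer than \<open>p\<close> points of
  \<open>blk x - {x}\<close>. Its orbits have 1 or \<open>p\<close> points, so all of these are
  singletons.\<close>

lemma fixing_blk:
  assumes h: "h \<in> H" "h x = x" and x: "x \<in> \<Omega>" and y: "y \<in> blk x"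
  shows "h y = y"
proof (cases "y = x")
  case False
  let ?K = "{h \<in> H. h x = x}"
  let ?O = "(\<lambda>h. h y) ` ?K"
  have "y \<in> \<Omega>" using blk_subset[OF x] y by blast
  then have c: "card ?O = 1 \<or> card ?O = p"
    using card_orbit_cases[OF subgroup_fixing[of x] _ \<open>y \<in> \<Omega>\<close>] by blast
  have "?O \<subseteq> blk x - {x}"
  proof
    fix z assume "z \<in> ?O"
    then obtain g where g: "g \<in> H" "g x = x" "z = g y" by (elim imageE) blast
    have "z \<in> blk y" using g blkI by simp
    moreover have "z \<noteq> x" using g False H_inverses(1)[OF g(1), of x] H_inverses(1)[OF g(1), of y] by auto
    ultimately show "z \<in> blk x - {x}" using blk_eq[OF y] by simp
  qed
  then have "card ?O \<le> card (blk x - {x})"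
    by (intro card_mono) (simp add: finite_blk)
  also have "\<dots> = card (blk x) - 1" using blk_self by (simp add: finite_blk)
  also have "\<dots> < p"
    using card_orbit_cases[OF subgroup_H _ x] p_gt_1 unfolding blk_def by fastforce
  finally have "card ?O = 1" using c by auto
  then obtain w where "?O = {w}" by (auto simp: card_1_singleton_iff)
  moreover have "y \<in> ?O" using imageI[of id ?K "\<lambda>h. h y"] H_id by simp
  moreover have "h y \<in> ?O" using imageI[of h ?K "\<lambda>h. h y"] h by simp
  ultimately show ?thesis by auto
qed (use h in simp)

lemma agree_blk:
  assumes h: "h \<in> H" "g \<in> H" "h x = g x" and x: "x \<in> \<Omega>" and y: "y \<in> blk x"
  shows "h y = g y"
proof -
  have "inv' g \<circ> h \<in> H" using h by (simp add: H_inv H_comp)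
  moreover have "(inv' g \<circ> h) x = x" using h by (simp add: H_inverses)
  ultimately have "(inv' g \<circ> h) y = y" using fixing_blk[OF _ _ x y] by blast
  then show ?thesis using H_inverses(2)[OF h(2), of "h y"] by simp
qed

lemma blocks_disjoint:
  assumes "A \<in> blocks" "B \<in> blocks" "x \<in> A" "x \<in> B"
  shows "A = B"
proof -
  obtain a b where ab: "A = blk a" "B = blk b" using assms by (auto simp: blocks_def)
  show ?thesis using blk_eq[of x a] blk_eq[of x b] assms ab by simp
qed

lemma finite_blocks: "finite blocks" by (simp add: blocks_def)

lemma block_subset: "B \<in> blocks \<Longrightarrow> B \<subseteq> \<Omega>"
  using blk_subset by (auto simp: blocks_def)

lemma finite_block: "B \<in> blocks \<Longrightarrow> finite B"
  by (rule finite_subset[OF block_subset finite_\<Omega>])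

lemma blk_in_blocks: "x \<in> \<Omega> \<Longrightarrow> blk x \<in> blocks"
  by (simp add: blocks_def)

lemma rep_in: "B \<in> blocks \<Longrightarrow> rep B \<in> B"
  unfolding rep_def by (rule someI_ex) (auto simp: blocks_def intro: blk_self)

lemma block_eq_blk: "B \<in> blocks \<Longrightarrow> x \<in> B \<Longrightarrow> B = blk x"
  using blk_eq by (auto simp: blocks_def)

lemma H_block: "h \<in> H \<Longrightarrow> B \<in> blocks \<Longrightarrow> x \<in> B \<Longrightarrow> h x \<in> B"
  using block_eq_blk[of B x] blkI by simp

lemma agree_block:
  assumes "h \<in> H" "g \<in> H" "B \<in> blocks" "x \<in> B" "h x = g x" "y \<in> B"
  shows "h y = g y"
  using agree_blk[of h g x y] assms block_eq_blk[of B x] block_subset[of B] by blast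

text \<open>
  An element of \<open>H\<close> is determined by its values at representatives of the orbits of size \<open>p\<close>.
  There are at most \<open>k\<close> such orbits, so comparing \<open>card H = p\<^sup>k\<close> with the number of possible
  values shows that there are exactly \<open>k\<close> and that all combinations of values occur.
\<close>

lemma blocks_and_evaluation:
  "\<And>B. B \<in> blocks \<Longrightarrow> card B = p"
  "bij_betw (\<lambda>h. \<lambda>B\<in>blocks. h (rep B)) H (Pi\<^sub>E blocks (\<lambda>B. B))"
proof -
  let ?P = "{B \<in> blocks. card B = p}"
  let ?ev = "\<lambda>h. \<lambda>B\<in>?P. h (rep B)"
  have finP: "finite ?P" using finite_blocks by simp
  have part: "p * card ?P = card (\<Union>?P)"
  proof (rule card_partition[OF finP])
    show "finite (\<Union>?P)" by (rule finite_subset[of _ \<Omega>]) (use block_subset in auto)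
    show "A \<inter> B = {}" if "A \<in> ?P" "B \<in> ?P" "A \<noteq> B" for A B
      using blocks_disjoint[of A B] that by blast
  qed simp
  also have le: "card (\<Union>?P) \<le> card \<Omega>" by (intro card_mono) (use block_subset in auto)
  finally have rk: "card ?P \<le> k" using p_gt_1 by (simp add: card_\<Omega>)
  have inj: "inj_on ?ev H"
  proof (rule inj_onI)
    fix h g assume hg: "h \<in> H" "g \<in> H" "?ev h = ?ev g"
    have "h x = g x" for x
    proof (cases "x \<in> \<Omega>")
      case True
      show ?thesis
      proof (cases "card (blk x) = p")
        case p: True
        then have B: "blk x \<in> ?P" using blk_in_blocks[OF True] by simp
        then have "h (rep (blk x)) = g (rep (blk x))"
          using fun_cong[OF hg(3), of "blk x"] by simp
        then show ?thesis using agree_block[OF hg(1,2), of "blk x"] B blk_self rep_in by blast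
      next
        case False
        then have "card (blk x) = 1"
          using card_orbit_cases[OF subgroup_H _ True] by (simp add: blk_def)
        then obtain w where "blk x = {w}" by (auto simp: card_1_singleton_iff)
        moreover have "h x \<in> blk x" "g x \<in> blk x" using hg blkI by simp_all
        ultimately show ?thesis by simp
      qed
    next
      case False
      then show ?thesis using H_permutes[OF hg(1)] H_permutes[OF hg(2)] by (simp add: permutes_def)
    qed
    then show "h = g" by blast
  qed
  have into: "?ev ` H \<subseteq> Pi\<^sub>E ?P (\<lambda>B. B)"
    by (intro image_subsetI PiE_I) (auto simp: H_block rep_in)
  have finPi: "finite (Pi\<^sub>E ?P (\<lambda>B. B))"
    using finP finite_block by (intro finite_PiE) simp_all
  have cardPi: "card (Pi\<^sub>E ?P (\<lambda>B. B)) = p ^ card ?P"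
    using finP by (simp add: card_PiE)
  have "p ^ k \<le> p ^ card ?P"
    using card_mono[OF finPi into] card_image[OF inj] card_H cardPi by simp
  then have r: "card ?P = k" using p_gt_1 rk by simp
  have eqP: "?ev ` H = Pi\<^sub>E ?P (\<lambda>B. B)"
    by (rule card_subset_eq[OF finPi into]) (simp add: card_image[OF inj] card_H cardPi r)
  \<comment> \<open>\<open>k\<close> disjoint orbits of \<open>p\<close> points already fill the
    \<open>p * k\<close> points, so no singleton orbit is left over.\<close>
  have "\<Union>?P = \<Omega>"
    by (rule card_subset_eq) (use block_subset r part card_\<Omega> in auto)
  then have "B \<in> ?P" if "B \<in> blocks" for B
    using that rep_in[OF that] block_subset[OF that] blocks_disjoint[OF that]
    by (metis (no_types, lifting) UnionE mem_Collect_eq subsetD)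
  then have P: "?P = blocks" by blast
  show "card B = p" if "B \<in> blocks" for B using that P by blast
  show "bij_betw (\<lambda>h. \<lambda>B\<in>blocks. h (rep B)) H (Pi\<^sub>E blocks (\<lambda>B. B))"
    using inj eqP by (simp only: bij_betw_def P)
qed

lemmas card_block = blocks_and_evaluation(1)
lemmas bij_betw_evaluation = blocks_and_evaluation(2)

section \<open>\<open>H\<close> as a direct product over its blocks\<close>

lemma obtain_H:
  assumes "\<And>B. B \<in> blocks \<Longrightarrow> v B \<in> B"
  obtains h where "h \<in> H" "\<And>B. B \<in> blocks \<Longrightarrow> h (rep B) = v B"
proof -
  have "restrict v blocks \<in> (\<lambda>h. \<lambda>B\<in>blocks. h (rep B)) ` H"
    using assms bij_betw_imp_surj_on[OF bij_betw_evaluation] by simp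
  then obtain h where h: "h \<in> H" "restrict v blocks = (\<lambda>B\<in>blocks. h (rep B))" by auto
  have "h (rep B) = v B" if "B \<in> blocks" for B
    using fun_cong[OF h(2), of B] that by simp
  with h(1) show thesis by (rule that)
qed

lemma permutes_eqI_blocks:
  assumes "f permutes \<Omega>" "g permutes \<Omega>" "\<And>B x. B \<in> blocks \<Longrightarrow> x \<in> B \<Longrightarrow> f x = g x"
  shows "f = g"
proof
  fix x show "f x = g x"
    using assms blk_in_blocks[of x] blk_self[of x] by (cases "x \<in> \<Omega>") (auto simp: permutes_def)
qed

text \<open>The values of \<open>f\<close> at the representatives are glued to a single
  \<open>h \<in> H\<close>; on each block the local witness agrees with \<open>h\<close> at one
  point, hence everywhere.\<close>

lemma H_memI:
  assumes f: "f permutes \<Omega>"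
    and loc: "\<And>B. B \<in> blocks \<Longrightarrow> \<exists>h\<in>H. \<forall>x\<in>B. f x = h x"
  shows "f \<in> H"
proof -
  obtain h where h: "h \<in> H" "\<And>B. B \<in> blocks \<Longrightarrow> h (rep B) = f (rep B)"
  proof (rule obtain_H[of "\<lambda>B. f (rep B)"])
    fix B assume B: "B \<in> blocks"
    then show "f (rep B) \<in> B" using loc[OF B] rep_in[OF B] H_block[OF _ B rep_in[OF B]] by auto
  qed blast
  have "f = h"
  proof (rule permutes_eqI_blocks[OF f H_permutes[OF h(1)]])
    fix B x assume B: "B \<in> blocks" "x \<in> B"
    obtain g where g: "g \<in> H" "\<forall>x\<in>B. f x = g x" using loc[OF B(1)] by blast
    have "g x = h x"
      using agree_block[OF g(1) h(1) B(1) rep_in[OF B(1)] _ B(2)] g(2) h(2)[OF B(1)] rep_in[OF B(1)]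
      by simp
    then show "f x = h x" using g(2) B(2) by simp
  qed
  then show ?thesis using h(1) by simp
qed

text \<open>The orbit of \<open>x\<close> under the powers of \<open>h\<close> has 1 or
  \<open>p\<close> points and contains both \<open>x\<close> and \<open>h x\<close>, so it is the
  whole block.\<close>

lemma transitive_generate:
  assumes h: "h \<in> H" and B: "B \<in> blocks" and x: "x \<in> B" "h x \<noteq> x" and y: "y \<in> B"
  shows "\<exists>u\<in>generate G {h}. u x = y"
proof -
  let ?K = "generate G {h}"
  have sub: "subgroup ?K G"
    using group.generate_is_subgroup[OF sym_group_is_group] H_permutes[OF h]
    by (simp add: carrier_G)
  have KH: "?K \<subseteq> H"
    using group.generate_subgroup_incl[OF sym_group_is_group _ subgroup_H] h by simp
  have hK: "h \<in> ?K" by (simp add: generate.incl)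
  have idK: "id \<in> ?K" using sub by (simp only: subgroup_G_iff)
  have "{x, h x} \<subseteq> (\<lambda>u. u x) ` ?K"
    using imageI[OF hK, of "\<lambda>u. u x"] imageI[OF idK, of "\<lambda>u. u x"] by simp
  then have "card ((\<lambda>u. u x) ` ?K) \<noteq> 1" using x(2) by (metis card_1_singletonE insert_subset singletonD)
  then have c: "card ((\<lambda>u. u x) ` ?K) = p"
    using card_orbit_cases[OF sub KH, of x] block_subset[OF B] x(1) by blast
  have "(\<lambda>u. u x) ` ?K \<subseteq> B" using KH H_block[OF _ B x(1)] by (intro image_subsetI) blast
  then have "(\<lambda>u. u x) ` ?K = B"
    using c by (intro card_subset_eq) (simp_all add: finite_block[OF B] card_block[OF B])
  with y have "y \<in> (\<lambda>u. u x) ` ?K" by simp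
  then show ?thesis by (elim imageE) (rule bexI, simp_all)
qed

section \<open>Supports and their generating function\<close>

definition supp :: "(nat \<Rightarrow> nat) \<Rightarrow> nat set set" where
  "supp h = {B \<in> blocks. h (rep B) \<noteq> rep B}"

lemma supp_subset: "supp h \<subseteq> blocks"
  by (auto simp: supp_def)

lemma finite_supp [simp]: "finite (supp h)"
  by (rule finite_subset[OF supp_subset finite_blocks])

text \<open>\<open>supp\<close> tests one representative per block. Any other point serves as well,
  because an element of \<open>H\<close> that fixes one point of a block fixes the block
  pointwise.\<close>

lemma in_supp_iff:
  assumes "h \<in> H" "B \<in> blocks" "x \<in> B"
  shows "B \<in> supp h \<longleftrightarrow> h x \<noteq> x"
  using agree_block[OF assms(1) H_id assms(2) rep_in[OF assms(2)], of x]
    agree_block[OF assms(1) H_id assms(2,3), of "rep B"] rep_in[OF assms(2)] assms(2,3)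
  by (auto simp: supp_def)

text \<open>Evaluation at representatives turns the sum over \<open>H\<close> into a sum over a
  product of blocks, and the weight factorizes. In a block of \<open>I\<close> one value has weight
  1 and the other \<open>p - 1\<close> have weight \<open>x\<close>; in a block outside
  \<open>I\<close> moving gets weight 0, which enforces \<open>supp h \<subseteq> I\<close>.\<close>

lemma sum_power_card_supp:
  fixes x :: real
  assumes I: "I \<subseteq> blocks"
  shows "(\<Sum>h\<in>{h \<in> H. supp h \<subseteq> I}. x ^ card (supp h)) = (1 + (real p - 1) * x) ^ card I"
proof -
  let ?w = "\<lambda>B y. if y = rep B then 1 else if B \<in> I then x else 0"
  let ?ev = "\<lambda>h. \<lambda>B\<in>blocks. h (rep B)"
  have w: "(\<Prod>B\<in>blocks. ?w B (h (rep B))) = (if supp h \<subseteq> I then x ^ card (supp h) else 0)" for h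
  proof (cases "supp h \<subseteq> I")
    case True
    have "(\<Prod>B\<in>blocks. ?w B (h (rep B))) = (\<Prod>B\<in>blocks. if h (rep B) \<noteq> rep B then x else 1)"
      using True by (intro prod.cong) (auto simp: supp_def)
    also have "\<dots> = (\<Prod>B\<in>supp h. x)"
      unfolding supp_def by (rule prod.inter_filter[symmetric, OF finite_blocks])
    finally show ?thesis using True by simp
  next
    case False
    then obtain B where "B \<in> blocks" "h (rep B) \<noteq> rep B" "B \<notin> I" by (auto simp: supp_def)
    then have "\<exists>B\<in>blocks. ?w B (h (rep B)) = 0" by (intro bexI[of _ B]) simp_all
    then have "(\<Prod>B\<in>blocks. ?w B (h (rep B))) = 0"
      by (subst prod_zero_iff[OF finite_blocks])
    then show ?thesis using False by simp
  qed
  have "(\<Sum>h\<in>{h \<in> H. supp h \<subseteq> I}. x ^ card (supp h)) =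
      (\<Sum>h\<in>H. if supp h \<subseteq> I then x ^ card (supp h) else 0)"
    by (rule sum.inter_filter[OF finite_H])
  also have "\<dots> = (\<Sum>h\<in>H. \<Prod>B\<in>blocks. ?w B (?ev h B))"
    by (simp add: w)
  also have "\<dots> = (\<Sum>f\<in>Pi\<^sub>E blocks (\<lambda>B. B). \<Prod>B\<in>blocks. ?w B (f B))"
    by (rule sum.reindex_bij_betw[OF bij_betw_evaluation])
  also have "\<dots> = (\<Prod>B\<in>blocks. \<Sum>y\<in>B. ?w B y)"
    by (rule prod_sum_PiE[symmetric, OF finite_blocks finite_block])
  also have "\<dots> = (\<Prod>B\<in>blocks. if B \<in> I then 1 + (real p - 1) * x else 1)"
  proof (rule prod.cong[OF refl])
    fix B assume B: "B \<in> blocks"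
    have "(\<Sum>y\<in>B. ?w B y) = ?w B (rep B) + (\<Sum>y\<in>B - {rep B}. ?w B y)"
      by (rule sum.remove[OF finite_block[OF B] rep_in[OF B]])
    also have "(\<Sum>y\<in>B - {rep B}. ?w B y) = (\<Sum>y\<in>B - {rep B}. if B \<in> I then x else 0)"
      by (rule sum.cong) simp_all
    also have "\<dots> = (real p - 1) * (if B \<in> I then x else 0)"
      using rep_in[OF B] p_gt_1 finite_block[OF B] card_block[OF B] by (simp add: of_nat_diff)
    finally show "(\<Sum>y\<in>B. ?w B y) = (if B \<in> I then 1 + (real p - 1) * x else 1)" by simp
  qed
  also have "\<dots> = (\<Prod>B\<in>{B \<in> blocks. B \<in> I}. 1 + (real p - 1) * x)"
    by (rule prod.inter_filter[symmetric, OF finite_blocks])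
  also have "{B \<in> blocks. B \<in> I} = I" using I by blast
  finally show ?thesis by simp
qed

text \<open>This is the derivative of the generating function at 1.\<close>

lemma sum_card_supp:
  assumes I: "I \<subseteq> blocks"
  shows "(\<Sum>h\<in>{h \<in> H. supp h \<subseteq> I}. real (card (supp h)))
    = (1 - 1 / real p) * real (card I) * real p ^ card I"
proof -
  let ?A = "{h \<in> H. supp h \<subseteq> I}"
  have "((\<lambda>x. \<Sum>h\<in>?A. x ^ card (supp h)) has_real_derivative
      (\<Sum>h\<in>?A. real (card (supp h)) * 1 ^ (card (supp h) - 1))) (at 1)"
    by (auto intro!: derivative_eq_intros)
  moreover have "((\<lambda>x. \<Sum>h\<in>?A. x ^ card (supp h)) has_real_derivative
      real (card I) * (1 + (real p - 1) * 1) ^ (card I - 1) * (real p - 1)) (at 1)"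
    unfolding sum_power_card_supp[OF I] by (auto intro!: derivative_eq_intros)
  ultimately have "(\<Sum>h\<in>?A. real (card (supp h)) * 1 ^ (card (supp h) - 1)) =
      real (card I) * (1 + (real p - 1) * 1) ^ (card I - 1) * (real p - 1)"
    by (rule DERIV_unique)
  then have "(\<Sum>h\<in>?A. real (card (supp h))) = real (card I) * real p ^ (card I - 1) * (real p - 1)"
    by simp
  also have "\<dots> = (1 - 1 / real p) * real (card I) * real p ^ card I"
    using p_gt_1 by (cases "card I") (simp_all add: field_simps)
  finally show ?thesis .
qed

section \<open>Intersections with conjugates\<close>

text \<open>This is the intersection of \<open>H\<close> with its conjugate \<tau> H \<tau>^-1,
  which is also the projection of the stabilizer of \<open>\<tau>\<close> to the first
  factor.\<close>

definition isect :: "(nat \<Rightarrow> nat) \<Rightarrow> (nat \<Rightarrow> nat) set" where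
  "isect \<tau> = {h \<in> H. inv' \<tau> \<circ> h \<circ> \<tau> \<in> H}"

definition shared :: "(nat \<Rightarrow> nat) \<Rightarrow> nat set set" where
  "shared \<tau> = {B \<in> blocks. \<exists>h\<in>isect \<tau>. B \<in> supp h}"

lemma shared_subset: "shared \<tau> \<subseteq> blocks"
  by (auto simp: shared_def)

lemma finite_shared [simp]: "finite (shared \<tau>)"
  by (rule finite_subset[OF shared_subset finite_blocks])

lemma isect_H: "h \<in> isect \<tau> \<Longrightarrow> h \<in> H"
  by (simp add: isect_def)

lemma subgroup_isect:
  assumes \<tau>: "\<tau> permutes \<Omega>"
  shows "subgroup (isect \<tau>) G"
  unfolding subgroup_G_iff
proof (intro conjI ballI)
  note \<tau>_inv = permutes_inverses[OF \<tau>]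
  show "id \<in> isect \<tau>"
    using H_id permutes_inv_o(2)[OF \<tau>] by (simp add: isect_def)
  fix f assume f: "f \<in> isect \<tau>"
  then have fH: "f \<in> H" "inv' \<tau> \<circ> f \<circ> \<tau> \<in> H" by (simp_all add: isect_def)
  show "f permutes \<Omega>" using fH(1) by (rule H_permutes)
  have "inv' (inv' \<tau> \<circ> f \<circ> \<tau>) = inv' \<tau> \<circ> inv' f \<circ> \<tau>"
  proof (rule inv_unique_comp)
    show "(inv' \<tau> \<circ> f \<circ> \<tau>) \<circ> (inv' \<tau> \<circ> inv' f \<circ> \<tau>) = id"
      by (simp add: fun_eq_iff \<tau>_inv H_inverses[OF fH(1)])
    show "(inv' \<tau> \<circ> inv' f \<circ> \<tau>) \<circ> (inv' \<tau> \<circ> f \<circ> \<tau>) = id"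
      by (simp add: fun_eq_iff \<tau>_inv H_inverses[OF fH(1)])
  qed
  then show "inv' f \<in> isect \<tau>"
    using H_inv[OF fH(1)] H_inv[OF fH(2)] by (simp add: isect_def)
  fix g assume g: "g \<in> isect \<tau>"
  then have gH: "g \<in> H" "inv' \<tau> \<circ> g \<circ> \<tau> \<in> H" by (simp_all add: isect_def)
  have "(inv' \<tau> \<circ> f \<circ> \<tau>) \<circ> (inv' \<tau> \<circ> g \<circ> \<tau>) = inv' \<tau> \<circ> (f \<circ> g) \<circ> \<tau>"
    by (simp add: fun_eq_iff \<tau>_inv)
  then show "f \<circ> g \<in> isect \<tau>"
    using H_comp[OF fH(1) gH(1)] H_comp[OF fH(2) gH(2)] by (simp add: isect_def)
qed

lemma generate_isect:
  assumes "\<tau> permutes \<Omega>" "h \<in> isect \<tau>"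
  shows "generate G {h} \<subseteq> isect \<tau>"
  using group.generate_subgroup_incl[OF sym_group_is_group _ subgroup_isect[OF assms(1)]] assms(2)
  by simp

text \<open>Any two points of \<open>B\<close> are linked by a power of \<open>h\<close>. Its
  conjugate under \<open>\<tau>\<close> lies in \<open>H\<close> and links their preimages, so the
  preimage of \<open>B\<close> lies in one orbit; both have \<open>p\<close> points.\<close>

lemma vimage_block:
  assumes \<tau>: "\<tau> permutes \<Omega>" and h: "h \<in> isect \<tau>" and B: "B \<in> supp h" and x: "x \<in> B"
  shows "inv' \<tau> ` B = blk (inv' \<tau> x)"
proof (rule card_subset_eq)
  note \<tau>_inv = permutes_inverses[OF \<tau>]
  have Bb: "B \<in> blocks" using B supp_subset by blast
  have xO: "inv' \<tau> x \<in> \<Omega>"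
    using permutes_in_image[OF permutes_inv[OF \<tau>]] block_subset[OF Bb] x by blast
  show "finite (blk (inv' \<tau> x))" by (rule finite_blk)
  show "inv' \<tau> ` B \<subseteq> blk (inv' \<tau> x)"
  proof (rule image_subsetI)
    fix y assume y: "y \<in> B"
    have "h x \<noteq> x" using in_supp_iff[OF isect_H[OF h] Bb x] B by simp
    then obtain u where u: "u \<in> generate G {h}" "u x = y"
      using transitive_generate[OF isect_H[OF h] Bb x _ y] by blast
    have "inv' \<tau> \<circ> u \<circ> \<tau> \<in> H"
      using generate_isect[OF \<tau> h] u(1) by (auto simp: isect_def)
    from blkI[OF this, of "inv' \<tau> x"] show "inv' \<tau> y \<in> blk (inv' \<tau> x)"
      using u(2) \<tau>_inv by simp
  qed
  have "inj_on (inv' \<tau>) B"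
    using permutes_inj[OF permutes_inv[OF \<tau>]] by (rule inj_on_subset) simp
  then show "card (inv' \<tau> ` B) = card (blk (inv' \<tau> x))"
    using card_block[OF Bb] card_block[OF blk_in_blocks[OF xO]] by (simp add: card_image)
qed

lemma vimage_shared_block:
  assumes \<tau>: "\<tau> permutes \<Omega>" and B: "B \<in> shared \<tau>" and x: "\<tau> x \<in> B"
  shows "y \<in> blk x \<longleftrightarrow> \<tau> y \<in> B"
proof -
  obtain h where h: "h \<in> isect \<tau>" "B \<in> supp h" using B by (auto simp: shared_def)
  have "inv' \<tau> ` B = blk x"
    using vimage_block[OF \<tau> h x] permutes_inverses[OF \<tau>] by simp
  moreover have "y \<in> inv' \<tau> ` B \<longleftrightarrow> \<tau> y \<in> B"
  proof
    assume "y \<in> inv' \<tau> ` B"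
    then show "\<tau> y \<in> B" by (elim imageE) (simp add: permutes_inverses[OF \<tau>])
  next
    assume "\<tau> y \<in> B"
    from imageI[OF this, of "inv' \<tau>"] show "y \<in> inv' \<tau> ` B"
      by (simp add: permutes_inverses[OF \<tau>])
  qed
  ultimately show ?thesis by simp
qed

text \<open>The intersection is the full subproduct over the shared blocks. For the inclusion from
  right to left, the conjugate of \<open>h\<close> is compared with elements of \<open>H\<close> one
  block at a time.\<close>

lemma isect_eq:
  assumes \<tau>: "\<tau> permutes \<Omega>"
  shows "isect \<tau> = {h \<in> H. supp h \<subseteq> shared \<tau>}"
proof (intro subset_antisym subsetI)
  fix h assume h: "h \<in> isect \<tau>"
  then have "supp h \<subseteq> shared \<tau>"
    using supp_subset by (auto simp: shared_def)
  then show "h \<in> {h \<in> H. supp h \<subseteq> shared \<tau>}" using isect_H[OF h] by simp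
next
  fix h assume "h \<in> {h \<in> H. supp h \<subseteq> shared \<tau>}"
  then have h: "h \<in> H" "supp h \<subseteq> shared \<tau>" by simp_all
  note \<tau>_inv = permutes_inverses[OF \<tau>]
  have "inv' \<tau> \<circ> h \<circ> \<tau> \<in> H"
  proof (rule H_memI)
    show "inv' \<tau> \<circ> h \<circ> \<tau> permutes \<Omega>"
      using \<tau> H_permutes[OF h(1)] by (simp add: permutes_compose permutes_inv)
    fix C assume C: "C \<in> blocks"
    define x where "x = rep C"
    have x: "x \<in> C" "x \<in> \<Omega>" "C = blk x"
      using rep_in[OF C] block_subset[OF C] block_eq_blk[OF C] by (auto simp: x_def)
    show "\<exists>g\<in>H. \<forall>y\<in>C. (inv' \<tau> \<circ> h \<circ> \<tau>) y = g y"
    proof (cases "blk (\<tau> x) \<in> shared \<tau>")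
      case True
      let ?B = "blk (\<tau> x)"
      have B: "?B \<in> blocks" using True shared_subset by blast
      obtain h0 where h0: "h0 \<in> isect \<tau>" "?B \<in> supp h0" using True by (auto simp: shared_def)
      have "h0 (\<tau> x) \<noteq> \<tau> x"
        using in_supp_iff[OF isect_H[OF h0(1)] B blk_self] h0(2) by simp
      \<comment> \<open>A power of \<open>h0\<close> that agrees with \<open>h\<close> at
        \<open>\<tau> x\<close> agrees with it on the whole block, and its conjugate is known to lie
        in \<open>H\<close>.\<close>
      then obtain u where u: "u \<in> generate G {h0}" "u (\<tau> x) = h (\<tau> x)"
        using transitive_generate[OF isect_H[OF h0(1)] B blk_self _ H_block[OF h(1) B blk_self]]
        by blast
      have uS: "u \<in> isect \<tau>" using generate_isect[OF \<tau> h0(1)] u(1) by blast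
      have "(inv' \<tau> \<circ> h \<circ> \<tau>) y = (inv' \<tau> \<circ> u \<circ> \<tau>) y" if "y \<in> C" for y
      proof -
        have "\<tau> y \<in> ?B"
          using vimage_shared_block[OF \<tau> True blk_self, of y] that x(3) by simp
        then show ?thesis
          using agree_block[OF isect_H[OF uS] h(1) B blk_self u(2)] by simp
      qed
      moreover have "inv' \<tau> \<circ> u \<circ> \<tau> \<in> H" using uS by (simp add: isect_def)
      ultimately show ?thesis by blast
    next
      case False
      have "(inv' \<tau> \<circ> h \<circ> \<tau>) y = id y" if y: "y \<in> C" for y
      proof -
        have yO: "\<tau> y \<in> \<Omega>"
          using permutes_in_image[OF \<tau>] block_subset[OF C] y by blast
        \<comment> \<open>Otherwise this block would be shared, its preimage would be all of
          \<open>C\<close>, and it would contain \<open>\<tau> x\<close>, against the case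
          assumption.\<close>
        have "blk (\<tau> y) \<notin> supp h"
        proof
          assume "blk (\<tau> y) \<in> supp h"
          then have s: "blk (\<tau> y) \<in> shared \<tau>" using h(2) by blast
          have "x \<in> blk y" using block_eq_blk[OF C y] x(1) by simp
          then have "\<tau> x \<in> blk (\<tau> y)"
            using vimage_shared_block[OF \<tau> s blk_self, of x] by simp
          from blk_eq[OF this] show False using s False by simp
        qed
        then have "h (\<tau> y) = \<tau> y"
          using in_supp_iff[OF h(1) blk_in_blocks[OF yO] blk_self] by simp
        then show ?thesis using \<tau>_inv by simp
      qed
      then show ?thesis using H_id by blast
    qed
  qed
  then show "h \<in> isect \<tau>" using h(1) by (simp add: isect_def)
qed

text \<open>The generating function at 1 counts the subproduct.\<close>

lemma card_isect:
  assumes \<tau>: "\<tau> permutes \<Omega>"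
  shows "card (isect \<tau>) = p ^ card (shared \<tau>)"
proof -
  have "real (card (isect \<tau>)) = real p ^ card (shared \<tau>)"
    using sum_power_card_supp[OF shared_subset, of 1 \<tau>] by (simp add: isect_eq[OF \<tau>])
  then show ?thesis by (metis of_nat_eq_iff of_nat_power)
qed

end

section \<open>Counting permutations that conjugate block cycles\<close>

text \<open>Cancelling the factorials leaves \<open>l * l \<le> (p * l choose p)\<close>, which
  holds since the binomial coefficient is at least \<open>l ^ p\<close>. The inequality turns the
  union bound over pairs of blocks into the error \<open>1 / fact (p - 2)\<close>.\<close>

lemma square_fact_le_fact:
  assumes "1 \<le> l" "2 \<le> p"
  shows "l * l * (p * (p - 1) * fact (p * l - p)) * fact (p - 2) \<le> (fact (p * l) :: nat)"
proof -
  have le: "p \<le> p * l" using assms by simp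
  have "real (l ^ p) = (real (p * l) / real p) ^ p" using assms by simp
  also have "\<dots> \<le> real (p * l choose p)"
    by (rule binomial_ge_n_over_k_pow_k[OF le])
  finally have "l ^ p \<le> p * l choose p" by simp
  moreover have "l ^ 2 \<le> l ^ p" using assms by (intro power_increasing) simp_all
  ultimately have ll: "l * l \<le> p * l choose p" by (simp add: power2_eq_square)
  obtain q where q: "p = Suc (Suc q)" using assms by (metis add_2_eq_Suc le_Suc_ex)
  have fp: "p * (p - 1) * fact (p - 2) = (fact p :: nat)" by (simp add: q algebra_simps)
  have "l * l * (p * (p - 1) * fact (p * l - p)) * fact (p - 2)
      = l * l * (fact p * fact (p * l - p))"
    by (simp only: fp[symmetric] mult_ac)
  also have "\<dots> \<le> (p * l choose p) * (fact p * fact (p * l - p))"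
    by (rule mult_right_mono[OF ll]) simp
  also have "\<dots> = fact (p * l)"
    using binomial_fact_lemma[OF le] by (simp add: mult_ac)
  finally show ?thesis .
qed

context sylow_perm_group
begin

text \<open>Commutation passes to powers of \<open>d\<close>; with transitivity on a block this
  spreads one fixed point of \<open>w\<close> over the whole block.\<close>

lemma commute_generate:
  assumes d: "d \<in> H" and comm: "w \<circ> d = d \<circ> w" and u: "u \<in> generate G {d}"
  shows "w \<circ> u = u \<circ> w"
  using u
proof (induction rule: generate.induct)
  case one
  then show ?case by (simp add: sym_group_one)
next
  case (incl h)
  then show ?case using comm by simp
next
  case (inv h)
  have "inv\<^bsub>G\<^esub> d = inv' d"
    using H_permutes[OF d] by (intro sym_group_inv_equality) (simp add: carrier_G)
  moreover have "w (inv' d x) = inv' d (w x)" for x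
    using fun_cong[OF comm, of "inv' d x"] H_inverses[OF d] by (metis comp_apply)
  moreover have "h = d" using inv by simp
  ultimately have "w ((inv\<^bsub>G\<^esub> h) x) = (inv\<^bsub>G\<^esub> h) (w x)" for x by simp
  then show ?case by (simp add: fun_eq_iff)
next
  case (eng h1 h2)
  have "w (h1 (h2 x)) = h1 (h2 (w x))" for x
    using fun_cong[OF eng.IH(1), of "h2 x"] fun_cong[OF eng.IH(2), of x] by simp
  then show ?case by (simp add: sym_group_mult fun_eq_iff)
qed

text \<open>
  A permutation of \<open>X\<close> that conjugates \<open>d\<close> into \<open>e\<close> is determined on the block moved by
  \<open>d\<close> by the image of a single point of that block.
\<close>

lemma card_conjugating_le:
  assumes d: "d \<in> H" "supp d = {B}" and X: "finite X" "B \<subseteq> X"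
    and Q: "finite Q" "\<And>x. e x \<noteq> x \<Longrightarrow> x \<in> Q"
  shows "card {\<rho>. \<rho> permutes X \<and> e \<circ> \<rho> = \<rho> \<circ> d} \<le> card Q * fact (card X - p)"
proof -
  let ?R = "{\<rho>. \<rho> permutes X \<and> e \<circ> \<rho> = \<rho> \<circ> d}"
  let ?x = "rep B"
  have B: "B \<in> blocks" "d ?x \<noteq> ?x" using d(2) by (auto simp: supp_def)
  \<comment> \<open>\<open>d\<close> moves the representative, so \<open>e\<close> moves its image;
    this leaves at most \<open>card Q\<close> possible images.\<close>
  have img: "\<rho> ?x \<in> Q" if "\<rho> \<in> ?R" for \<rho>
  proof (rule Q(2))
    have "e (\<rho> ?x) = \<rho> (d ?x)" using that by (auto dest: fun_cong)
    moreover have "\<rho> (d ?x) \<noteq> \<rho> ?x" using that B(2) permutes_inj[of \<rho> X] by (auto dest: injD)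
    ultimately show "e (\<rho> ?x) \<noteq> \<rho> ?x" by simp
  qed
  have finR: "finite ?R"
    by (rule finite_subset[OF _ finite_permutations[OF X(1)]]) auto
  have fib: "card {\<rho> \<in> ?R. \<rho> ?x = y} \<le> fact (card X - p)" for y
  proof (cases "{\<rho> \<in> ?R. \<rho> ?x = y} = {}")
    case True
    show ?thesis unfolding True by simp
  next
    case False
    then obtain \<rho>0 where \<rho>0: "\<rho>0 permutes X" "e \<circ> \<rho>0 = \<rho>0 \<circ> d" "\<rho>0 ?x = y" by auto
    note inv0 = permutes_inverses[OF \<rho>0(1)]
    let ?f = "\<lambda>\<rho>. inv' \<rho>0 \<circ> \<rho>"
    \<comment> \<open>Two solutions with the same image of the representative differ by a
      permutation that commutes with \<open>d\<close> and fixes the representative, hence fixes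
      \<open>B\<close> pointwise.\<close>
    have "?f \<rho> permutes (X - B)" if \<rho>: "\<rho> permutes X" "e \<circ> \<rho> = \<rho> \<circ> d" "\<rho> ?x = y" for \<rho>
    proof -
      have "inv' \<rho>0 (\<rho> (d z)) = d (inv' \<rho>0 (\<rho> z))" for z
      proof -
        have "\<rho> (d z) = e (\<rho> z)" using fun_cong[OF \<rho>(2), of z] by simp
        also have "\<dots> = \<rho>0 (d (inv' \<rho>0 (\<rho> z)))"
          using fun_cong[OF \<rho>0(2), of "inv' \<rho>0 (\<rho> z)"] inv0 by simp
        finally show ?thesis using inv0 by simp
      qed
      then have comm: "?f \<rho> \<circ> d = d \<circ> ?f \<rho>" by (simp add: fun_eq_iff)
      have fixx: "?f \<rho> ?x = ?x" using \<rho>(3) \<rho>0(3) inv0 by (metis comp_apply)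
      have fixB: "?f \<rho> z = z" if z: "z \<in> B" for z
      proof -
        obtain u where u: "u \<in> generate G {d}" "u ?x = z"
          using transitive_generate[OF d(1) B(1) rep_in[OF B(1)] B(2) z] by blast
        show ?thesis
          using fun_cong[OF commute_generate[OF d(1) comm u(1)], of ?x] fixx u(2) by simp
      qed
      have "?f \<rho> permutes X"
        by (rule permutes_compose[OF \<rho>(1) permutes_inv[OF \<rho>0(1)]])
      then show ?thesis
        by (rule permutes_superset) (use fixB in auto)
    qed
    then have into: "?f ` {\<rho> \<in> ?R. \<rho> ?x = y} \<subseteq> {w. w permutes (X - B)}"
      by blast
    have "inj_on ?f {\<rho> \<in> ?R. \<rho> ?x = y}"
    proof (rule inj_onI)
      fix \<rho> \<rho>' assume eq: "?f \<rho> = ?f \<rho>'"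
      have "\<rho> z = \<rho>' z" for z
      proof -
        have "\<rho>0 (?f \<rho> z) = \<rho>0 (?f \<rho>' z)" using eq by simp
        then show ?thesis using inv0 by simp
      qed
      then show "\<rho> = \<rho>'" by blast
    qed
    then have "card {\<rho> \<in> ?R. \<rho> ?x = y} \<le> card {w. w permutes (X - B)}"
      by (rule card_inj_on_le[OF _ into]) (simp add: finite_permutations X(1))
    also have "\<dots> = fact (card (X - B))"
      by (rule card_permutations) (simp_all add: X(1))
    also have "card (X - B) = card X - p"
      using X finite_block[OF B(1)] card_block[OF B(1)] by (simp add: card_Diff_subset)
    finally show ?thesis .
  qed
  have "?R = (\<Union>y\<in>Q. {\<rho> \<in> ?R. \<rho> ?x = y})" using img by blast
  then have "card ?R \<le> (\<Sum>y\<in>Q. card {\<rho> \<in> ?R. \<rho> ?x = y})"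
    using card_UN_le[OF Q(1), of "\<lambda>y. {\<rho> \<in> ?R. \<rho> ?x = y}"] by (simp only:)
  also have "\<dots> \<le> (\<Sum>y\<in>Q. fact (card X - p))" by (rule sum_mono) (rule fib)
  finally show ?thesis by simp
qed

section \<open>Fixed points of a pair \<open>(h, g)\<close> in the symmetric group\<close>

definition conj_set :: "(nat \<Rightarrow> nat) \<Rightarrow> (nat \<Rightarrow> nat) \<Rightarrow> (nat \<Rightarrow> nat) set" where
  "conj_set h g = {\<tau>. \<tau> permutes \<Omega> \<and> h \<circ> \<tau> = \<tau> \<circ> g}"

definition fixed :: "(nat \<Rightarrow> nat) \<Rightarrow> nat set" where
  "fixed h = {x \<in> \<Omega>. h x = x}"

lemma finite_conj_set: "finite (conj_set h g)"
  by (rule finite_subset[OF _ finite_permutations[OF finite_\<Omega>]]) (auto simp: conj_set_def)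

lemma conj_set_isect:
  assumes "h \<in> H" "g \<in> H" "\<tau> \<in> conj_set h g"
  shows "h \<in> isect \<tau>"
proof -
  have \<tau>: "\<tau> permutes \<Omega>" "h \<circ> \<tau> = \<tau> \<circ> g" using assms(3) by (simp_all add: conj_set_def)
  have "inv' \<tau> \<circ> h \<circ> \<tau> = g"
    using fun_cong[OF \<tau>(2)] by (simp add: fun_eq_iff permutes_inverses[OF \<tau>(1)])
  then show ?thesis using assms by (simp add: isect_def)
qed

text \<open>Conjugation by \<open>\<tau>\<close> takes \<open>h\<close> to \<open>g \<in> H\<close>,
  so \<open>h\<close> lies in \<open>isect \<tau>\<close>: the blocks moved by \<open>h\<close>
  survive a step to \<open>\<tau>\<close>.\<close>

lemma conj_set_supp_subset:
  assumes "h \<in> H" "g \<in> H" "\<tau> \<in> conj_set h g"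
  shows "supp h \<subseteq> shared \<tau>"
  using conj_set_isect[OF assms] assms(3) isect_eq[of \<tau>] by (auto simp: conj_set_def)

lemma fixed_eq:
  assumes h: "h \<in> H"
  shows "fixed h = \<Union> (blocks - supp h)"
proof (intro subset_antisym subsetI)
  fix x assume "x \<in> fixed h"
  then have x: "x \<in> \<Omega>" "h x = x" by (simp_all add: fixed_def)
  then have "blk x \<in> blocks - supp h"
    using in_supp_iff[OF h blk_in_blocks blk_self] blk_in_blocks by simp
  then show "x \<in> \<Union> (blocks - supp h)" using blk_self by blast
next
  fix x assume "x \<in> \<Union> (blocks - supp h)"
  then obtain B where B: "B \<in> blocks" "B \<notin> supp h" "x \<in> B" by blast
  then have "h x = x" using in_supp_iff[OF h B(1,3)] by simp
  then show "x \<in> fixed h" using block_subset[OF B(1)] B(3) by (auto simp: fixed_def)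
qed

lemma card_fixed:
  assumes h: "h \<in> H"
  shows "card (fixed h) = p * card (blocks - supp h)"
proof -
  have "p * card (blocks - supp h) = card (\<Union> (blocks - supp h))"
  proof (rule card_partition)
    show "finite (\<Union> (blocks - supp h))"
      by (rule finite_subset[of _ \<Omega>]) (use block_subset in auto)
    show "A \<inter> B = {}" if "A \<in> blocks - supp h" "B \<in> blocks - supp h" "A \<noteq> B" for A B
      using blocks_disjoint[of A B] that by blast
  qed (simp_all add: finite_blocks card_block)
  then show ?thesis by (simp add: fixed_eq[OF h])
qed

lemma conj_set_fixed:
  assumes \<tau>: "\<tau> \<in> conj_set h g"
  shows "\<tau> x \<in> fixed h \<longleftrightarrow> x \<in> fixed g"
proof -
  have p: "\<tau> permutes \<Omega>" "h (\<tau> x) = \<tau> (g x)"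
    using \<tau> by (auto simp: conj_set_def dest: fun_cong)
  show ?thesis
    using permutes_in_image[OF p(1), of x] inj_eq[OF permutes_inj[OF p(1)], of "g x" x] p(2)
    by (auto simp: fixed_def)
qed

text \<open>\<open>\<tau>\<close> maps the fixed points of \<open>g\<close> bijectively onto those
  of \<open>h\<close>, and each fixed block accounts for \<open>p\<close> of them.\<close>

lemma conj_set_card_eq:
  assumes "h \<in> H" "g \<in> H" "\<tau> \<in> conj_set h g"
  shows "card (blocks - supp h) = card (blocks - supp g)"
proof -
  have \<tau>: "\<tau> permutes \<Omega>" using assms(3) by (simp add: conj_set_def)
  have "\<tau> ` fixed g = fixed h"
  proof (intro subset_antisym subsetI)
    fix x assume "x \<in> \<tau> ` fixed g"
    then show "x \<in> fixed h" by (elim imageE) (simp add: conj_set_fixed[OF assms(3)])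
  next
    fix x assume "x \<in> fixed h"
    then have "inv' \<tau> x \<in> fixed g"
      using conj_set_fixed[OF assms(3), of "inv' \<tau> x"] permutes_inverses[OF \<tau>] by simp
    from imageI[OF this, of \<tau>] show "x \<in> \<tau> ` fixed g"
      using permutes_inverses[OF \<tau>] by simp
  qed
  then have "card (fixed h) = card (fixed g)"
    using card_image[of \<tau> "fixed g"] inj_on_subset[OF permutes_inj[OF \<tau>]] by simp
  then show ?thesis using card_fixed assms p_gt_1 by simp
qed

text \<open>A permutation of the fixed points of \<open>g\<close> commutes with \<open>g\<close>,
  since \<open>g\<close> preserves both this set and its complement.\<close>

lemma conj_set_comp:
  assumes g: "g \<in> H" and \<rho>: "\<rho> permutes fixed g" and \<tau>: "\<tau> \<in> conj_set h g"
  shows "\<tau> \<circ> \<rho> \<in> conj_set h g"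
proof -
  have \<tau>': "\<tau> permutes \<Omega>" "h \<circ> \<tau> = \<tau> \<circ> g" using \<tau> by (simp_all add: conj_set_def)
  have comm: "g (\<rho> x) = \<rho> (g x)" for x
  proof (cases "x \<in> fixed g")
    case True
    then have "\<rho> x \<in> fixed g" using permutes_in_image[OF \<rho>] by simp
    then show ?thesis using True by (simp add: fixed_def)
  next
    case False
    have "g x \<notin> fixed g"
    proof
      assume "g x \<in> fixed g"
      then have "g x \<in> \<Omega>" "g (g x) = g x" by (simp_all add: fixed_def)
      then have "g x = x" "x \<in> \<Omega>"
        using H_inverses(1)[OF g, of "g x"] H_inverses(1)[OF g, of x]
          permutes_in_image[OF H_permutes[OF g], of x] by simp_all
      then show False using False by (simp add: fixed_def)
    qed
    then show ?thesis using False permutes_not_in[OF \<rho>] by simp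
  qed
  have "\<rho> permutes \<Omega>"
    by (rule permutes_subset[OF \<rho>]) (auto simp: fixed_def)
  then have "\<tau> \<circ> \<rho> permutes \<Omega>" by (rule permutes_compose) (rule \<tau>'(1))
  moreover have "h \<circ> (\<tau> \<circ> \<rho>) = (\<tau> \<circ> \<rho>) \<circ> g"
    using fun_cong[OF \<tau>'(2)] comm by (simp add: fun_eq_iff)
  ultimately show ?thesis by (simp add: conj_set_def)
qed

lemma obtain_single:
  assumes B: "B \<in> blocks"
  shows "\<exists>c\<in>H. supp c = {B}"
proof -
  have "B \<noteq> {rep B}" using card_block[OF B] p_gt_1 by (metis card_1_singleton_iff less_irrefl One_nat_def)
  then obtain y where y: "y \<in> B" "y \<noteq> rep B" using rep_in[OF B] by blast
  obtain c where c: "c \<in> H" "\<And>A. A \<in> blocks \<Longrightarrow> c (rep A) = (if A = B then y else rep A)"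
    by (rule obtain_H[of "\<lambda>A. if A = B then y else rep A"]) (use y rep_in in auto)
  have "supp c = {B}" using c(2) B y(2) by (auto simp: supp_def split: if_splits)
  then show ?thesis using c(1) by blast
qed

text \<open>Such an element is determined by its block and by the image of the representative, for
  which \<open>p - 1\<close> values are possible.\<close>

lemma card_singles_le:
  assumes "R \<subseteq> blocks"
  shows "card {d \<in> H. \<exists>B\<in>R. supp d = {B}} \<le> card R * (p - 1)"
proof -
  let ?D = "{d \<in> H. \<exists>B\<in>R. supp d = {B}}"
  let ?f = "\<lambda>d. (the_elem (supp d), d (rep (the_elem (supp d))))"
  let ?S = "Sigma R (\<lambda>B. B - {rep B})"
  have finR: "finite R" using assms finite_blocks by (rule finite_subset)
  have "inj_on ?f ?D"
  proof (rule inj_onI)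
    fix d d' assume d: "d \<in> ?D" "d' \<in> ?D" "?f d = ?f d'"
    then obtain B B' where B: "supp d = {B}" "supp d' = {B'}" by blast
    with d(3) have BB: "B = B'" "d (rep B) = d' (rep B)" by auto
    have dH: "d \<in> H" "d' \<in> H" using d by auto
    show "d = d'"
    proof (rule permutes_eqI_blocks[OF H_permutes[OF dH(1)] H_permutes[OF dH(2)]])
      fix A x assume A: "A \<in> blocks" "x \<in> A"
      have "d (rep A) = d' (rep A)"
      proof (cases "A = B")
        case False
        then have "A \<notin> supp d" "A \<notin> supp d'" using B BB by auto
        then show ?thesis using A(1) by (simp add: supp_def)
      qed (use BB in simp)
      then show "d x = d' x" using agree_block[OF dH A(1) rep_in[OF A(1)] _ A(2)] by blast
    qed
  qed
  moreover have "?f ` ?D \<subseteq> ?S"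
  proof (rule image_subsetI)
    fix d assume "d \<in> ?D"
    then obtain B where d: "d \<in> H" "B \<in> R" "supp d = {B}" by blast
    then have "B \<in> blocks" "d (rep B) \<noteq> rep B" by (auto simp: supp_def)
    then show "?f d \<in> ?S" using d H_block[OF d(1) _ rep_in] by simp
  qed
  moreover have "finite ?S" using finR finite_block assms by (intro finite_SigmaI) auto
  ultimately have "card ?D \<le> card ?S" by (rule card_inj_on_le)
  also have "card ?S = (\<Sum>B\<in>R. card (B - {rep B}))"
    using finR finite_block assms by (intro card_SigmaI) auto
  also have "\<dots> = (\<Sum>B\<in>R. p - 1)"
  proof (rule sum.cong[OF refl])
    fix B assume "B \<in> R"
    then have B: "B \<in> blocks" using assms by blast
    show "card (B - {rep B}) = p - 1"
      using finite_block[OF B] rep_in[OF B] card_block[OF B] by simp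
  qed
  finally show ?thesis by simp
qed

text \<open>
  Averaging over right translations by the permutations of the fixed points of \<open>g\<close>, which act
  freely on \<open>conj_set h g\<close>, reduces the count to \<open>card_conjugating_le\<close>.
\<close>

lemma card_conj_set_conj_le:
  assumes h: "h \<in> H" and g: "g \<in> H" and c: "c \<in> H" "supp c = {A}"
    and d: "d \<in> H" "supp d = {B}" "B \<notin> supp g"
  defines "N \<equiv> card (fixed g)"
  shows "card {\<tau> \<in> conj_set h g. c \<circ> \<tau> = \<tau> \<circ> d} * fact N \<le> card (conj_set h g) * (p * fact (N - p))"
proof -
  let ?T = "conj_set h g"
  let ?X = "fixed g"
  let ?L = "{\<rho>. \<rho> permutes ?X}"
  let ?P = "\<lambda>\<tau>. c \<circ> \<tau> = \<tau> \<circ> d"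
  have X: "finite ?X" "B \<subseteq> ?X"
    using d block_subset[of B] by (auto simp: fixed_eq[OF g] supp_def finite_blocks finite_block)
  have finL: "finite ?L" by (rule finite_permutations[OF X(1)])
  have cardL: "card ?L = fact N" unfolding N_def by (rule card_permutations[OF refl X(1)])
  have A: "A \<in> blocks" using c(2) supp_subset by blast
  \<comment> \<open>Right translation by \<open>\<rho>\<close> is a bijection of \<open>?T\<close>,
    so the count is the same for every \<open>\<rho>\<close>.\<close>
  have shift: "card {\<tau> \<in> ?T. ?P (\<tau> \<circ> \<rho>)} = card {\<tau> \<in> ?T. ?P \<tau>}" if \<rho>: "\<rho> \<in> ?L" for \<rho>
  proof -
    have \<rho>': "\<rho> permutes ?X" "inv' \<rho> permutes ?X" using \<rho> permutes_inv by simp_all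
    have canc: "\<tau> \<circ> \<rho> \<circ> inv' \<rho> = \<tau>" "\<tau> \<circ> inv' \<rho> \<circ> \<rho> = \<tau>" for \<tau> :: "nat \<Rightarrow> nat"
      by (simp_all add: fun_eq_iff permutes_inverses[OF \<rho>'(1)])
    have "bij_betw (\<lambda>\<tau>. \<tau> \<circ> \<rho>) {\<tau> \<in> ?T. ?P (\<tau> \<circ> \<rho>)} {\<tau> \<in> ?T. ?P \<tau>}"
    proof (rule bij_betw_byWitness[where f' = "\<lambda>\<tau>. \<tau> \<circ> inv' \<rho>"])
      show "(\<lambda>\<tau>. \<tau> \<circ> \<rho>) ` {\<tau> \<in> ?T. ?P (\<tau> \<circ> \<rho>)} \<subseteq> {\<tau> \<in> ?T. ?P \<tau>}"
        using conj_set_comp[OF g \<rho>'(1)] by (intro image_subsetI) simp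
      show "(\<lambda>\<tau>. \<tau> \<circ> inv' \<rho>) ` {\<tau> \<in> ?T. ?P \<tau>} \<subseteq> {\<tau> \<in> ?T. ?P (\<tau> \<circ> \<rho>)}"
        using conj_set_comp[OF g \<rho>'(2)] by (intro image_subsetI CollectI conjI) (simp_all only: canc mem_Collect_eq)
    qed (simp_all only: canc Ball_def, simp_all)
    then show ?thesis by (rule bij_betw_same_card)
  qed
  have inner: "card {\<rho> \<in> ?L. ?P (\<tau> \<circ> \<rho>)} \<le> p * fact (N - p)" if \<tau>: "\<tau> \<in> ?T" for \<tau>
  proof -
    have \<tau>p: "\<tau> permutes \<Omega>" using \<tau> by (simp add: conj_set_def)
    note \<tau>_inv = permutes_inverses[OF \<tau>p]
    let ?e = "inv' \<tau> \<circ> c \<circ> \<tau>"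
    let ?Q = "inv' \<tau> ` A"
    have Q: "x \<in> ?Q" if "?e x \<noteq> x" for x
    proof -
      have ne: "c (\<tau> x) \<noteq> \<tau> x" using that \<tau>_inv by auto
      then have "\<tau> x \<in> \<Omega>" using permutes_not_in[OF H_permutes[OF c(1)]] by blast
      then have "blk (\<tau> x) \<in> supp c"
        using in_supp_iff[OF c(1) blk_in_blocks blk_self] ne by simp
      then have "\<tau> x \<in> A" using c(2) blk_self by blast
      from imageI[OF this, of "inv' \<tau>"] show ?thesis using \<tau>_inv by simp
    qed
    have "card {\<rho> \<in> ?L. ?P (\<tau> \<circ> \<rho>)} \<le> card {\<rho>. \<rho> permutes ?X \<and> ?e \<circ> \<rho> = \<rho> \<circ> d}"
    proof (rule card_mono)
      show "finite {\<rho>. \<rho> permutes ?X \<and> ?e \<circ> \<rho> = \<rho> \<circ> d}"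
        by (rule finite_subset[OF _ finL]) auto
      show "{\<rho> \<in> ?L. ?P (\<tau> \<circ> \<rho>)} \<subseteq> {\<rho>. \<rho> permutes ?X \<and> ?e \<circ> \<rho> = \<rho> \<circ> d}"
      proof (intro subsetI CollectI conjI)
        fix \<rho> assume \<rho>: "\<rho> \<in> {\<rho> \<in> ?L. ?P (\<tau> \<circ> \<rho>)}"
        then show "\<rho> permutes ?X" by simp
        have "c (\<tau> (\<rho> x)) = \<tau> (\<rho> (d x))" for x using \<rho> by (auto dest: fun_cong)
        then show "?e \<circ> \<rho> = \<rho> \<circ> d" by (simp add: fun_eq_iff \<tau>_inv)
      qed
    qed
    also have "\<dots> \<le> card ?Q * fact (card ?X - p)"
      by (rule card_conjugating_le[OF d(1,2) X _ Q]) (simp_all add: finite_block[OF A])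
    also have "card ?Q \<le> p"
      using card_image_le[OF finite_block[OF A], of "inv' \<tau>"] card_block[OF A] by simp
    finally show ?thesis by (simp add: N_def)
  qed
  \<comment> \<open>Pairs of \<open>\<rho>\<close> and \<open>\<tau>\<close> are counted in both
    orders.\<close>
  have "card {\<tau> \<in> ?T. ?P \<tau>} * fact N = (\<Sum>\<rho>\<in>?L. card {\<tau> \<in> ?T. ?P (\<tau> \<circ> \<rho>)})"
    using shift by (simp add: cardL)
  also have "\<dots> = (\<Sum>\<rho>\<in>?L. \<Sum>\<tau>\<in>?T. if ?P (\<tau> \<circ> \<rho>) then 1 else 0)"
    by (simp add: sum.inter_filter[OF finite_conj_set, symmetric])
  also have "\<dots> = (\<Sum>\<tau>\<in>?T. \<Sum>\<rho>\<in>?L. if ?P (\<tau> \<circ> \<rho>) then 1 else 0)"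
    by (rule sum.swap)
  also have "\<dots> = (\<Sum>\<tau>\<in>?T. card {\<rho> \<in> ?L. ?P (\<tau> \<circ> \<rho>)})"
    by (simp only: sum.inter_filter[OF finL, symmetric] card_eq_sum)
  also have "\<dots> \<le> (\<Sum>\<tau>\<in>?T. p * fact (N - p))"
    by (rule sum_mono) (rule inner)
  finally show ?thesis by simp
qed

text \<open>
  Every block in \<open>shared \<tau> - supp h\<close> is the support of some \<open>c \<in> H\<close> that \<open>\<tau>\<close> conjugates into
  some \<open>d \<in> H\<close> supported on a single block fixed by \<open>g\<close>. A union bound over \<open>l\<close> choices of
  \<open>c\<close> and \<open>l (p - 1)\<close> choices of \<open>d\<close> gives the estimate.
\<close>

lemma sum_card_excess:
  assumes h: "h \<in> H" and g: "g \<in> H"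
  shows "(\<Sum>\<tau>\<in>conj_set h g. card (shared \<tau> - supp h)) * fact (p - 2) \<le> card (conj_set h g)"
proof (cases "conj_set h g = {} \<or> supp h = blocks")
  case True
  have "card (shared \<tau> - supp h) = 0" if "\<tau> \<in> conj_set h g" for \<tau>
  proof -
    have "shared \<tau> - supp h = {}" using that True shared_subset[of \<tau>] by blast
    then show ?thesis by simp
  qed
  then have "(\<Sum>\<tau>\<in>conj_set h g. card (shared \<tau> - supp h)) = 0"
    by (intro sum.neutral ballI)
  then show ?thesis by (simp only: mult_0)
next
  case False
  let ?T = "conj_set h g"
  define R where "R = blocks - supp g"
  define l where "l = card R"
  let ?D = "{d \<in> H. \<exists>B\<in>R. supp d = {B}}"
  obtain \<tau>0 where \<tau>0: "\<tau>0 \<in> ?T" using False by blast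
  have lh: "card (blocks - supp h) = l"
    using conj_set_card_eq[OF h g \<tau>0] by (simp add: l_def R_def)
  have "blocks - supp h \<noteq> {}" using False supp_subset[of h] by blast
  then have l1: "1 \<le> l" using lh finite_blocks by (metis Suc_leI card_gt_0_iff finite_Diff One_nat_def)
  have N: "card (fixed g) = p * l" using card_fixed[OF g] by (simp add: l_def R_def)
  have finD: "finite ?D" using finite_H by simp
  \<comment> \<open>One fixed element per block suffices: if \<open>B\<close> is shared, every
    element of \<open>H\<close> supported on \<open>B\<close> lies in
    \<open>isect \<tau>\<close>.\<close>
  define c where "c B = (SOME c. c \<in> H \<and> supp c = {B})" for B
  have c: "c B \<in> H" "supp (c B) = {B}" if "B \<in> blocks" for B
    using someI_ex[of "\<lambda>c. c \<in> H \<and> supp c = {B}"] obtain_single[OF that]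
    by (auto simp: c_def Bex_def)
  have pt: "card (shared \<tau> - supp h) \<le>
      (\<Sum>B\<in>blocks - supp h. \<Sum>d\<in>?D. if c B \<circ> \<tau> = \<tau> \<circ> d then 1 else 0)" if \<tau>: "\<tau> \<in> ?T" for \<tau>
  proof -
    have \<tau>p: "\<tau> permutes \<Omega>" "\<And>x. h (\<tau> x) = \<tau> (g x)"
      using \<tau> by (auto simp: conj_set_def dest: fun_cong)
    note \<tau>_inv = permutes_inverses[OF \<tau>p(1)]
    \<comment> \<open>The witness is the conjugate of \<open>c B\<close> by \<open>\<tau>\<close>.
      It moves exactly the preimage of \<open>B\<close>, which is a single block, and
      \<open>g\<close> fixes this block because \<open>h\<close> fixes \<open>B\<close>.\<close>
    have one: "1 \<le> (\<Sum>d\<in>?D. if c B \<circ> \<tau> = \<tau> \<circ> d then 1 else 0 :: nat)"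
      if B: "B \<in> shared \<tau> - supp h" for B
    proof -
      have Bb: "B \<in> blocks" using B shared_subset by blast
      define d where "d = inv' \<tau> \<circ> c B \<circ> \<tau>"
      have "c B \<in> isect \<tau>" using B c[OF Bb] by (simp add: isect_eq[OF \<tau>p(1)])
      then have dH: "d \<in> H" by (simp add: isect_def d_def)
      have cd: "c B \<circ> \<tau> = \<tau> \<circ> d" by (simp add: d_def fun_eq_iff \<tau>_inv)
      define x where "x = inv' \<tau> (rep B)"
      have x: "\<tau> x \<in> B" "x \<in> \<Omega>"
        using rep_in[OF Bb] block_subset[OF Bb] permutes_in_image[OF permutes_inv[OF \<tau>p(1)]]
        by (auto simp: x_def \<tau>_inv)
      let ?A = "blk x"
      have A: "?A \<in> blocks" using x(2) by (rule blk_in_blocks)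
      have inB: "y \<in> ?A \<longleftrightarrow> \<tau> y \<in> B" for y
        using vimage_shared_block[OF \<tau>p(1) _ x(1)] B by blast
      have moved: "d y \<noteq> y \<longleftrightarrow> \<tau> y \<in> B" for y
      proof -
        have "d y \<noteq> y \<longleftrightarrow> c B (\<tau> y) \<noteq> \<tau> y" using \<tau>_inv by (metis d_def comp_apply)
        also have "\<dots> \<longleftrightarrow> \<tau> y \<in> B"
        proof (cases "\<tau> y \<in> \<Omega>")
          case True
          have "c B (\<tau> y) \<noteq> \<tau> y \<longleftrightarrow> blk (\<tau> y) = B"
            using in_supp_iff[OF c(1)[OF Bb] blk_in_blocks[OF True] blk_self] c(2)[OF Bb] by simp
          also have "\<dots> \<longleftrightarrow> \<tau> y \<in> B" using block_eq_blk[OF Bb] blk_self by blast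
          finally show ?thesis .
        next
          case False
          then show ?thesis
            using permutes_not_in[OF H_permutes[OF c(1)[OF Bb]]] block_subset[OF Bb] by blast
        qed
        finally show ?thesis .
      qed
      have "C \<in> supp d \<longleftrightarrow> C = ?A" if C: "C \<in> blocks" for C
        using in_supp_iff[OF dH C rep_in[OF C]] moved[of "rep C"] inB[of "rep C"]
          blocks_disjoint[OF A C _ rep_in[OF C]] rep_in[OF A] rep_in[OF C] by blast
      then have sd: "supp d = {?A}" using supp_subset[of d] A by blast
      have "h (\<tau> x) = \<tau> x" using in_supp_iff[OF h Bb x(1)] B by simp
      then have "g x = x" using \<tau>p(2)[of x] \<tau>_inv by metis
      then have "?A \<in> R" using in_supp_iff[OF g A blk_self] A by (simp add: R_def)
      then have "d \<in> ?D" using dH sd by blast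
      then have "(if c B \<circ> \<tau> = \<tau> \<circ> d then 1 else 0 :: nat)
          \<le> (\<Sum>d\<in>?D. if c B \<circ> \<tau> = \<tau> \<circ> d then 1 else 0)"
        by (intro member_le_sum finD) simp_all
      then show ?thesis using cd by simp
    qed
    have "card (shared \<tau> - supp h) = (\<Sum>B\<in>shared \<tau> - supp h. 1)" by simp
    also have "\<dots> \<le> (\<Sum>B\<in>shared \<tau> - supp h. \<Sum>d\<in>?D. if c B \<circ> \<tau> = \<tau> \<circ> d then 1 else 0)"
      by (rule sum_mono) (rule one)
    also have "\<dots> \<le> (\<Sum>B\<in>blocks - supp h. \<Sum>d\<in>?D. if c B \<circ> \<tau> = \<tau> \<circ> d then 1 else 0)"
      by (rule sum_mono2) (use finite_blocks shared_subset in auto)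
    finally show ?thesis .
  qed
  let ?S = "\<Sum>\<tau>\<in>?T. card (shared \<tau> - supp h)"
  let ?q = "p * fact (p * l - p) :: nat"
  have "?S \<le> (\<Sum>\<tau>\<in>?T. \<Sum>B\<in>blocks - supp h. \<Sum>d\<in>?D. if c B \<circ> \<tau> = \<tau> \<circ> d then 1 else 0)"
    by (rule sum_mono) (rule pt)
  also have "\<dots> = (\<Sum>B\<in>blocks - supp h. \<Sum>\<tau>\<in>?T. \<Sum>d\<in>?D. if c B \<circ> \<tau> = \<tau> \<circ> d then 1 else 0)"
    by (rule sum.swap)
  also have "\<dots> = (\<Sum>B\<in>blocks - supp h. \<Sum>d\<in>?D. \<Sum>\<tau>\<in>?T. if c B \<circ> \<tau> = \<tau> \<circ> d then 1 else 0)"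
    by (intro sum.cong refl sum.swap)
  also have "\<dots> = (\<Sum>B\<in>blocks - supp h. \<Sum>d\<in>?D. card {\<tau> \<in> ?T. c B \<circ> \<tau> = \<tau> \<circ> d})"
    by (simp only: sum.inter_filter[OF finite_conj_set, symmetric] card_eq_sum)
  finally have "?S * fact (p * l) \<le>
      (\<Sum>B\<in>blocks - supp h. \<Sum>d\<in>?D. card {\<tau> \<in> ?T. c B \<circ> \<tau> = \<tau> \<circ> d}) * fact (p * l)"
    by (rule mult_right_mono) simp
  also have "\<dots> = (\<Sum>B\<in>blocks - supp h. \<Sum>d\<in>?D. card {\<tau> \<in> ?T. c B \<circ> \<tau> = \<tau> \<circ> d} * fact (p * l))"
    by (simp only: sum_distrib_right)
  also have "\<dots> \<le> (\<Sum>B\<in>blocks - supp h. \<Sum>d\<in>?D. card ?T * ?q)"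
  proof (intro sum_mono)
    fix B d assume B: "B \<in> blocks - supp h" and d: "d \<in> ?D"
    then obtain A where A: "supp d = {A}" "A \<in> R" by blast
    have "B \<in> blocks" "d \<in> H" "A \<notin> supp g" using B d A by (auto simp: R_def)
    then show "card {\<tau> \<in> ?T. c B \<circ> \<tau> = \<tau> \<circ> d} * fact (p * l) \<le> card ?T * ?q"
      using card_conj_set_conj_le[OF h g c _ A(1)] by (simp add: N)
  qed
  also have "\<dots> = l * (card ?D * (card ?T * ?q))" by (simp add: lh)
  also have "\<dots> \<le> l * ((l * (p - 1)) * (card ?T * ?q))"
    using card_singles_le[of R] by (intro mult_left_mono mult_right_mono) (simp_all add: R_def l_def)
  finally have S: "?S * fact (p * l) \<le> (l * l * (p * (p - 1) * fact (p * l - p))) * card ?T"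
    by (simp add: mult_ac)
  let ?w = "l * l * (p * (p - 1) * fact (p * l - p)) :: nat"
  \<comment> \<open>Multiplying by the positive factor \<open>?w\<close> and cancelling it
    afterwards avoids division of natural numbers.\<close>
  have "(?S * fact (p - 2)) * ?w = ?S * (?w * fact (p - 2))" by (simp only: mult_ac)
  also have "\<dots> \<le> ?S * fact (p * l)"
    using square_fact_le_fact[OF l1, of p] p_gt_1 by (intro mult_left_mono) simp_all
  also have "\<dots> \<le> card ?T * ?w" using S by (simp only: mult_ac)
  finally have "(?S * fact (p - 2)) * ?w \<le> card ?T * ?w" .
  moreover have "0 < ?w" using l1 p_gt_1 by simp
  ultimately show ?thesis by (simp only: mult_le_cancel2)
qed

end

section \<open>The Markov chain\<close>

text \<open>Pointwise, the absolute difference is the sum minus twice the minimum. Bounds on the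
  overlap of the two distributions thus give bounds on the distance.\<close>

lemma tv_dist_eq_min:
  assumes "(\<Sum>x\<in>S. \<mu> x) = 1" "(\<Sum>x\<in>S. \<nu> x) = 1"
  shows "tv_dist S \<mu> \<nu> = 1 - (\<Sum>x\<in>S. min (\<mu> x) (\<nu> x))"
proof -
  have "(\<Sum>x\<in>S. \<bar>\<mu> x - \<nu> x\<bar>) = (\<Sum>x\<in>S. \<mu> x + \<nu> x - 2 * min (\<mu> x) (\<nu> x))"
    by (rule sum.cong) (auto simp: min_def abs_if)
  then show ?thesis
    using assms by (simp add: tv_dist_def sum.distrib sum_subtractf flip: sum_distrib_left)
qed

text \<open>Conditioning on the state before the last step lets one-step estimates be inserted into
  expectations at time \<open>Suc t\<close>.\<close>

lemma sum_chain_dist_Suc: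
  "(\<Sum>y\<in>S. chain_dist S K x (Suc t) y * f y) =
    (\<Sum>z\<in>S. chain_dist S K x t z * (\<Sum>y\<in>S. K z y * f y))"
proof -
  have "(\<Sum>y\<in>S. chain_dist S K x (Suc t) y * f y) =
      (\<Sum>y\<in>S. \<Sum>z\<in>S. chain_dist S K x t z * (K z y * f y))"
    by (simp add: sum_distrib_right mult.assoc)
  also have "\<dots> = (\<Sum>z\<in>S. \<Sum>y\<in>S. chain_dist S K x t z * (K z y * f y))"
    by (rule sum.swap)
  finally show ?thesis by (simp add: sum_distrib_left)
qed

lemma chain_dist_nonneg:
  assumes "\<And>z y. z \<in> S \<Longrightarrow> y \<in> S \<Longrightarrow> 0 \<le> K z y" "y \<in> S"
  shows "0 \<le> chain_dist S K x t y"
  using assms(2) by (induction t arbitrary: y) (auto intro!: sum_nonneg simp: assms(1))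

lemma sum_chain_dist_0:
  assumes "finite S" "x \<in> S"
  shows "(\<Sum>y\<in>S. chain_dist S K x 0 y * f y) = f x"
proof -
  have "(\<Sum>y\<in>S. chain_dist S K x 0 y * f y) = (\<Sum>y\<in>S. if x = y then f y else 0)"
    by (rule sum.cong) simp_all
  also have "\<dots> = f x" using assms by (simp add: sum.delta)
  finally show ?thesis .
qed

lemma sum_chain_dist:
  assumes "finite S" "x \<in> S" "\<And>z. z \<in> S \<Longrightarrow> (\<Sum>y\<in>S. K z y) = 1"
  shows "(\<Sum>y\<in>S. chain_dist S K x t y) = 1"
proof (induction t)
  case 0
  show ?case using sum_chain_dist_0[OF assms(1,2), of K "\<lambda>_. 1"] by simp
next
  case (Suc t)
  then show ?case using sum_chain_dist_Suc[of S K x t "\<lambda>_. 1"] assms(3) by simp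
qed

context sylow_perm_group
begin

lemma finite_carrier_G: "finite (carrier G)"
  using finite_permutations[OF finite_\<Omega>] by (simp add: carrier_G[symmetric])

lemmas G_facts = sym_group_is_group subgroup_H finite_carrier_G

lemma two_sided_act_G:
  assumes "h \<in> H"
  shows "two_sided_act G (h, g) \<sigma> = \<sigma> \<longleftrightarrow> h \<circ> \<sigma> = \<sigma> \<circ> g"
proof -
  have "inv\<^bsub>G\<^esub> h = inv' h"
    using H_permutes[OF assms] by (intro sym_group_inv_equality) (simp add: carrier_G)
  then have act: "two_sided_act G (h, g) \<sigma> = inv' h \<circ> \<sigma> \<circ> g"
    by (simp add: two_sided_act_def sym_group_mult)
  show ?thesis
  proof
    assume "two_sided_act G (h, g) \<sigma> = \<sigma>"
    then have "inv' h (\<sigma> (g x)) = \<sigma> x" for x using act by (auto dest: fun_cong)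
    then have "h (\<sigma> x) = \<sigma> (g x)" for x using H_inverses(2)[OF assms, of "\<sigma> (g x)"] by simp
    then show "h \<circ> \<sigma> = \<sigma> \<circ> g" by (simp add: fun_eq_iff)
  next
    assume comm: "h \<circ> \<sigma> = \<sigma> \<circ> g"
    have "\<sigma> (g x) = h (\<sigma> x)" for x using fun_cong[OF comm, of x] by simp
    then show "two_sided_act G (h, g) \<sigma> = \<sigma>"
      using act by (simp add: fun_eq_iff H_inverses[OF assms])
  qed
qed

lemma invariants_G:
  assumes "h \<in> H"
  shows "invariants (carrier G) (two_sided_act G) (h, g) = conj_set h g"
  using two_sided_act_G[OF assms] by (auto simp: invariants_def conj_set_def carrier_G)

section \<open>One step of the chain as a choice of \<open>h\<close> followed by a choice of
  \<open>\<tau>\<close>\<close>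

abbreviation conj_by :: "(nat \<Rightarrow> nat) \<Rightarrow> (nat \<Rightarrow> nat) \<Rightarrow> nat \<Rightarrow> nat" where
  "conj_by \<sigma> h \<equiv> inv' \<sigma> \<circ> h \<circ> \<sigma>"

text \<open>The second component of a stabilizing pair is forced to be the conjugate of the
  first.\<close>

lemma act_stabilizer_G:
  assumes "\<sigma> permutes \<Omega>"
  shows "act_stabilizer G H \<sigma> = (\<lambda>h. (h, conj_by \<sigma> h)) ` isect \<sigma>"
proof -
  note \<sigma>_inv = permutes_inverses[OF assms]
  have eq: "h \<circ> \<sigma> = \<sigma> \<circ> g \<longleftrightarrow> g = conj_by \<sigma> h" for h g
  proof
    assume "h \<circ> \<sigma> = \<sigma> \<circ> g"
    then have "h (\<sigma> x) = \<sigma> (g x)" for x by (auto dest: fun_cong)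
    then show "g = conj_by \<sigma> h" by (simp add: fun_eq_iff \<sigma>_inv)
  qed (simp add: fun_eq_iff \<sigma>_inv)
  have "(h, g) \<in> act_stabilizer G H \<sigma> \<longleftrightarrow> h \<in> isect \<sigma> \<and> g = conj_by \<sigma> h" for h g
    using two_sided_act_G[of h g \<sigma>] eq[of h g]
    by (auto simp: act_stabilizer_iff[OF G_facts] isect_def)
  then show ?thesis by (auto simp: image_iff)
qed

lemma card_act_stabilizer:
  assumes "\<sigma> permutes \<Omega>"
  shows "card (act_stabilizer G H \<sigma>) = p ^ card (shared \<sigma>)"
  using card_isect[OF assms] by (simp add: act_stabilizer_G[OF assms] card_image inj_on_def)

abbreviation K :: "(nat \<Rightarrow> nat) \<Rightarrow> (nat \<Rightarrow> nat) \<Rightarrow> real" where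
  "K \<equiv> burnside_kernel G H"

text \<open>Exchanging the sums exhibits the step as two-stage sampling: \<open>h\<close> uniform in
  \<open>isect \<sigma>\<close>, then \<open>\<tau>\<close> uniform in the matching
  \<open>conj_set\<close>.\<close>

lemma kernel_sum:
  assumes \<sigma>: "\<sigma> permutes \<Omega>"
  shows "(\<Sum>\<tau>\<in>carrier G. K \<sigma> \<tau> * f \<tau>) =
    1 / real p ^ card (shared \<sigma>) *
    (\<Sum>h\<in>isect \<sigma>. (\<Sum>\<tau>\<in>conj_set h (conj_by \<sigma> h). f \<tau>) / real (card (conj_set h (conj_by \<sigma> h))))"
proof -
  let ?A = "act_stabilizer G H"
  let ?I = "invariants (carrier G) (two_sided_act G)"
  have sub: "?I hg = {\<tau> \<in> carrier G. hg \<in> ?A \<tau>}" if "hg \<in> ?A \<sigma>" for hg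
    using that by (auto simp: act_stabilizer_iff[OF G_facts] invariants_def)
  have "(\<Sum>\<tau>\<in>carrier G. K \<sigma> \<tau> * f \<tau>) =
     (\<Sum>\<tau>\<in>carrier G. 1 / real (card (?A \<sigma>)) *
        (\<Sum>hg\<in>?A \<sigma>. if hg \<in> ?A \<tau> then f \<tau> / real (card (?I hg)) else 0))"
  proof (rule sum.cong[OF refl])
    fix \<tau>
    have "(\<Sum>hg\<in>?A \<sigma> \<inter> ?A \<tau>. 1 / real (card (?I hg))) * f \<tau> =
      (\<Sum>hg\<in>?A \<sigma>. if hg \<in> ?A \<tau> then f \<tau> / real (card (?I hg)) else 0)"
      by (simp add: sum_distrib_right finite_act_stabilizer[OF G_facts] flip: sum.inter_restrict)
    then show "K \<sigma> \<tau> * f \<tau> = 1 / real (card (?A \<sigma>)) *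
        (\<Sum>hg\<in>?A \<sigma>. if hg \<in> ?A \<tau> then f \<tau> / real (card (?I hg)) else 0)"
      by (simp add: burnside_kernel_def)
  qed
  also have "\<dots> = 1 / real (card (?A \<sigma>)) *
     (\<Sum>\<tau>\<in>carrier G. \<Sum>hg\<in>?A \<sigma>. if hg \<in> ?A \<tau> then f \<tau> / real (card (?I hg)) else 0)"
    by (rule sum_distrib_left[symmetric])
  also have "(\<Sum>\<tau>\<in>carrier G. \<Sum>hg\<in>?A \<sigma>. if hg \<in> ?A \<tau> then f \<tau> / real (card (?I hg)) else 0) =
     (\<Sum>hg\<in>?A \<sigma>. \<Sum>\<tau>\<in>carrier G. if hg \<in> ?A \<tau> then f \<tau> / real (card (?I hg)) else 0)"
    by (rule sum.swap)
  also have "\<dots> = (\<Sum>hg\<in>?A \<sigma>. (\<Sum>\<tau>\<in>?I hg. f \<tau>) / real (card (?I hg)))"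
  proof (rule sum.cong[OF refl])
    fix hg assume hg: "hg \<in> ?A \<sigma>"
    have "(\<Sum>\<tau>\<in>carrier G. if hg \<in> ?A \<tau> then f \<tau> / real (card (?I hg)) else 0) =
        (\<Sum>\<tau>\<in>{\<tau> \<in> carrier G. hg \<in> ?A \<tau>}. f \<tau> / real (card (?I hg)))"
      by (rule sum.inter_filter[symmetric, OF finite_carrier_G])
    then show "(\<Sum>\<tau>\<in>carrier G. if hg \<in> ?A \<tau> then f \<tau> / real (card (?I hg)) else 0) =
        (\<Sum>\<tau>\<in>?I hg. f \<tau>) / real (card (?I hg))"
      by (simp only: sub[OF hg] sum_divide_distrib)
  qed
  also have "\<dots> = (\<Sum>h\<in>isect \<sigma>. (\<Sum>\<tau>\<in>?I (h, conj_by \<sigma> h). f \<tau>) / real (card (?I (h, conj_by \<sigma> h))))"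
    unfolding act_stabilizer_G[OF \<sigma>] by (subst sum.reindex) (auto simp: inj_on_def)
  also have "\<dots> = (\<Sum>h\<in>isect \<sigma>. (\<Sum>\<tau>\<in>conj_set h (conj_by \<sigma> h). f \<tau>) / real (card (conj_set h (conj_by \<sigma> h))))"
    by (rule sum.cong) (simp_all add: invariants_G isect_H)
  finally show ?thesis by (simp add: card_act_stabilizer[OF \<sigma>])
qed

abbreviation s :: real where "s \<equiv> 1 - 1 / real p"

abbreviation \<delta> :: real where "\<delta> \<equiv> 1 / fact (p - 2)"

abbreviation m :: "(nat \<Rightarrow> nat) \<Rightarrow> nat" where "m \<sigma> \<equiv> card (shared \<sigma>)"

text \<open>A common template for the one-step estimates: \<open>F\<close> is the contribution of
  the blocks retained by \<open>h\<close>, and \<open>b\<close> is the price per block gained by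
  \<open>\<tau>\<close>. The average gain is at most \<open>\<delta>\<close> by
  \<open>sum_card_excess\<close>. Lower bounds come from negating \<open>f\<close>.\<close>

lemma kernel_sum_le:
  assumes \<sigma>: "\<sigma> permutes \<Omega>" and b: "0 \<le> b"
    and f: "\<And>h \<tau>. h \<in> isect \<sigma> \<Longrightarrow> \<tau> \<in> conj_set h (conj_by \<sigma> h) \<Longrightarrow>
      f \<tau> \<le> F (card (supp h)) + b * real (card (shared \<tau> - supp h))"
  shows "(\<Sum>\<tau>\<in>carrier G. K \<sigma> \<tau> * f \<tau>) \<le>
    1 / real p ^ m \<sigma> * (\<Sum>h\<in>{h \<in> H. supp h \<subseteq> shared \<sigma>}. F (card (supp h))) + b * \<delta>"
proof -
  have avg: "(\<Sum>\<tau>\<in>conj_set h (conj_by \<sigma> h). f \<tau>) / real (card (conj_set h (conj_by \<sigma> h)))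
      \<le> F (card (supp h)) + b * \<delta>" if h: "h \<in> isect \<sigma>" for h
  proof -
    let ?T = "conj_set h (conj_by \<sigma> h)"
    have gH: "conj_by \<sigma> h \<in> H" using h by (simp add: isect_def)
    have "\<sigma> \<in> ?T" using \<sigma> by (simp add: conj_set_def fun_eq_iff permutes_inverses[OF \<sigma>])
    then have pos: "0 < real (card ?T)" using finite_conj_set by (auto simp: card_gt_0_iff)
    have "real ((\<Sum>\<tau>\<in>?T. card (shared \<tau> - supp h)) * fact (p - 2)) \<le> real (card ?T)"
      using sum_card_excess[OF isect_H[OF h] gH] by (simp only: of_nat_le_iff)
    then have ex: "(\<Sum>\<tau>\<in>?T. real (card (shared \<tau> - supp h))) \<le> real (card ?T) * \<delta>"
      by (simp add: field_simps)
    have "(\<Sum>\<tau>\<in>?T. f \<tau>) \<le> (\<Sum>\<tau>\<in>?T. F (card (supp h)) + b * real (card (shared \<tau> - supp h)))"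
      by (rule sum_mono) (rule f[OF h])
    also have "\<dots> = real (card ?T) * F (card (supp h)) + b * (\<Sum>\<tau>\<in>?T. real (card (shared \<tau> - supp h)))"
      by (simp add: sum.distrib sum_distrib_left)
    also have "\<dots> \<le> real (card ?T) * F (card (supp h)) + b * (real (card ?T) * \<delta>)"
      by (rule add_left_mono[OF mult_left_mono[OF ex b]])
    also have "\<dots> = (F (card (supp h)) + b * \<delta>) * real (card ?T)"
      by (simp only: distrib_left mult_ac)
    finally show ?thesis using pos by (simp only: pos_divide_le_eq)
  qed
  have p0: "0 < real p ^ m \<sigma>" using p_gt_1 by simp
  have "(\<Sum>\<tau>\<in>carrier G. K \<sigma> \<tau> * f \<tau>) \<le>
      1 / real p ^ m \<sigma> * (\<Sum>h\<in>isect \<sigma>. F (card (supp h)) + b * \<delta>)"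
    unfolding kernel_sum[OF \<sigma>]
    by (rule mult_left_mono[OF sum_mono[OF avg]]) (use p0 in \<open>simp_all add: less_imp_le\<close>)
  also have "\<dots> = 1 / real p ^ m \<sigma> * ((\<Sum>h\<in>isect \<sigma>. F (card (supp h))) + real p ^ m \<sigma> * (b * \<delta>))"
    by (simp add: sum.distrib card_isect[OF \<sigma>])
  also have "\<dots> = 1 / real p ^ m \<sigma> * (\<Sum>h\<in>isect \<sigma>. F (card (supp h))) + b * \<delta>"
    using p0 by (simp add: distrib_left)
  finally show ?thesis by (simp only: isect_eq[OF \<sigma>])
qed

text \<open>This is the generating function of a binomial variable with \<open>m \<sigma>\<close>
  trials and success probability \<open>s\<close>.\<close>

lemma average_power_card_supp:
  "1 / real p ^ m \<sigma> * (\<Sum>h\<in>{h \<in> H. supp h \<subseteq> shared \<sigma>}. x ^ card (supp h)) = (1 - s * (1 - x)) ^ m \<sigma>"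
proof -
  have "(1 - s * (1 - x)) = (1 + (real p - 1) * x) / real p"
    using p_gt_1 by (simp add: field_simps)
  then show ?thesis
    by (simp add: sum_power_card_supp[OF shared_subset] power_divide)
qed

lemma conj_set_supp_subset':
  assumes "h \<in> isect \<sigma>" "\<tau> \<in> conj_set h (conj_by \<sigma> h)"
  shows "supp h \<subseteq> shared \<tau>"
  using conj_set_supp_subset[OF isect_H[OF assms(1)] _ assms(2)] assms(1) by (simp add: isect_def)

text \<open>Gained blocks can only decrease \<open>x ^ m \<tau>\<close>, so the price is
  \<open>b = 0\<close> and no error term appears.\<close>

lemma kernel_power_le:
  assumes \<sigma>: "\<sigma> permutes \<Omega>" and x: "0 \<le> x" "x \<le> 1"
  shows "(\<Sum>\<tau>\<in>carrier G. K \<sigma> \<tau> * x ^ m \<tau>) \<le> (1 - s * (1 - x)) ^ m \<sigma>"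
proof -
  have "(\<Sum>\<tau>\<in>carrier G. K \<sigma> \<tau> * x ^ m \<tau>) \<le>
    1 / real p ^ m \<sigma> * (\<Sum>h\<in>{h \<in> H. supp h \<subseteq> shared \<sigma>}. x ^ card (supp h)) + 0 * \<delta>"
  proof (rule kernel_sum_le[OF \<sigma>])
    fix h \<tau> assume "h \<in> isect \<sigma>" "\<tau> \<in> conj_set h (conj_by \<sigma> h)"
    then have "card (supp h) \<le> m \<tau>" by (intro card_mono conj_set_supp_subset') simp_all
    then show "x ^ m \<tau> \<le> x ^ card (supp h) + 0 * real (card (shared \<tau> - supp h))"
      using x by (simp add: power_decreasing)
  qed simp
  then show ?thesis by (simp only: average_power_card_supp mult_zero_left add_0_right)
qed

lemma kernel_power_ge:
  assumes \<sigma>: "\<sigma> permutes \<Omega>" and x: "0 \<le> x" "x \<le> 1"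
  shows "(1 - s * (1 - x)) ^ m \<sigma> - \<delta> \<le> (\<Sum>\<tau>\<in>carrier G. K \<sigma> \<tau> * x ^ m \<tau>)"
proof -
  have "(\<Sum>\<tau>\<in>carrier G. K \<sigma> \<tau> * - (x ^ m \<tau>)) \<le>
    1 / real p ^ m \<sigma> * (\<Sum>h\<in>{h \<in> H. supp h \<subseteq> shared \<sigma>}. - (x ^ card (supp h))) + 1 * \<delta>"
  proof (rule kernel_sum_le[OF \<sigma>])
    fix h \<tau> assume "h \<in> isect \<sigma>" "\<tau> \<in> conj_set h (conj_by \<sigma> h)"
    then have sub: "supp h \<subseteq> shared \<tau>" by (rule conj_set_supp_subset')
    \<comment> \<open>If nothing is gained the powers coincide; otherwise the gain is at least 1,
      which already bounds the left side.\<close>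
    have "x ^ card (supp h) \<le> x ^ m \<tau> + real (card (shared \<tau> - supp h))"
    proof (cases "shared \<tau> - supp h = {}")
      case True
      then have "shared \<tau> = supp h" using sub by blast
      then show ?thesis by simp
    next
      case False
      then have "1 \<le> card (shared \<tau> - supp h)"
        by (simp add: card_gt_0_iff Suc_leI)
      then have "1 \<le> real (card (shared \<tau> - supp h))" by simp
      moreover have "x ^ card (supp h) \<le> 1" using x by (simp add: power_le_one)
      moreover have "0 \<le> x ^ m \<tau>" using x by simp
      ultimately show ?thesis by linarith
    qed
    then show "- (x ^ m \<tau>) \<le> - (x ^ card (supp h)) + 1 * real (card (shared \<tau> - supp h))"
      by simp
  qed simp
  then have "- (\<Sum>\<tau>\<in>carrier G. K \<sigma> \<tau> * x ^ m \<tau>) \<le>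
    - (1 / real p ^ m \<sigma> * (\<Sum>h\<in>{h \<in> H. supp h \<subseteq> shared \<sigma>}. x ^ card (supp h))) + \<delta>"
    by (simp add: sum_negf)
  then show ?thesis unfolding average_power_card_supp by linarith
qed

lemma kernel_mean_le:
  assumes \<sigma>: "\<sigma> permutes \<Omega>"
  shows "(\<Sum>\<tau>\<in>carrier G. K \<sigma> \<tau> * real (m \<tau>)) \<le> s * real (m \<sigma>) + \<delta>"
proof -
  have "(\<Sum>\<tau>\<in>carrier G. K \<sigma> \<tau> * real (m \<tau>)) \<le>
    1 / real p ^ m \<sigma> * (\<Sum>h\<in>{h \<in> H. supp h \<subseteq> shared \<sigma>}. real (card (supp h))) + 1 * \<delta>"
  proof (rule kernel_sum_le[OF \<sigma>])
    fix h \<tau> assume "h \<in> isect \<sigma>" "\<tau> \<in> conj_set h (conj_by \<sigma> h)"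
    then have "supp h \<subseteq> shared \<tau>" by (rule conj_set_supp_subset')
    then show "real (m \<tau>) \<le> real (card (supp h)) + 1 * real (card (shared \<tau> - supp h))"
      by (simp add: card_Diff_subset card_mono of_nat_diff)
  qed simp
  then show ?thesis using p_gt_1 by (simp add: sum_card_supp[OF shared_subset])
qed

section \<open>Iteration of the one-step estimates\<close>

abbreviation P :: "(nat \<Rightarrow> nat) \<Rightarrow> nat \<Rightarrow> (nat \<Rightarrow> nat) \<Rightarrow> real" where
  "P \<equiv> chain_dist (carrier G) K"

lemma K_nonneg: "\<sigma> \<in> carrier G \<Longrightarrow> \<tau> \<in> carrier G \<Longrightarrow> 0 \<le> K \<sigma> \<tau>"
  using burnside_kernel_pos[OF G_facts] by (simp add: less_imp_le)

lemma P_nonneg: "\<tau> \<in> carrier G \<Longrightarrow> 0 \<le> P \<sigma> t \<tau>"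
  by (rule chain_dist_nonneg[OF K_nonneg])

lemma s_bounds: "0 \<le> s" "s \<le> 1"
  using p_gt_1 by simp_all

text \<open>The last step replaces \<open>x\<close> by \<open>1 - s * (1 - x)\<close>, which stays
  in the unit interval. The induction therefore runs over all \<open>x\<close>, and the distance of
  the argument from 1 shrinks by the factor \<open>s\<close> each time.\<close>

lemma chain_power_le:
  assumes \<sigma>: "\<sigma> \<in> carrier G" and x: "0 \<le> x" "x \<le> 1"
  shows "(\<Sum>\<tau>\<in>carrier G. P \<sigma> t \<tau> * x ^ m \<tau>) \<le> (1 - s ^ t * (1 - x)) ^ m \<sigma>"
  using x
proof (induction t arbitrary: x)
  case 0
  have "(\<Sum>\<tau>\<in>carrier G. P \<sigma> 0 \<tau> * x ^ m \<tau>) = x ^ m \<sigma>"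
    by (rule sum_chain_dist_0[OF finite_carrier_G \<sigma>])
  then show ?case by simp
next
  case (Suc t)
  let ?x = "1 - s * (1 - x)"
  have "s * (1 - x) \<le> 1 * 1" using s_bounds Suc.prems by (intro mult_mono) simp_all
  moreover have "0 \<le> s * (1 - x)" using s_bounds Suc.prems by (intro mult_nonneg_nonneg) simp_all
  ultimately have x': "0 \<le> ?x" "?x \<le> 1" by linarith+
  have "(\<Sum>\<tau>\<in>carrier G. P \<sigma> (Suc t) \<tau> * x ^ m \<tau>) =
      (\<Sum>z\<in>carrier G. P \<sigma> t z * (\<Sum>\<tau>\<in>carrier G. K z \<tau> * x ^ m \<tau>))"
    by (rule sum_chain_dist_Suc)
  also have "\<dots> \<le> (\<Sum>z\<in>carrier G. P \<sigma> t z * ?x ^ m z)"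
    using kernel_power_le Suc.prems by (intro sum_mono mult_left_mono P_nonneg) (simp_all add: carrier_G)
  also have "\<dots> \<le> (1 - s ^ t * (1 - ?x)) ^ m \<sigma>" by (rule Suc.IH[OF x'])
  also have "s ^ t * (1 - ?x) = s ^ Suc t * (1 - x)" by simp
  finally show ?case .
qed

text \<open>The same induction, in which each step costs \<open>\<delta>\<close> because the total
  mass of the chain is 1.\<close>

lemma chain_power_ge:
  assumes \<sigma>: "\<sigma> \<in> carrier G" and x: "0 \<le> x" "x \<le> 1"
  shows "(1 - s ^ t * (1 - x)) ^ m \<sigma> - real t * \<delta> \<le> (\<Sum>\<tau>\<in>carrier G. P \<sigma> t \<tau> * x ^ m \<tau>)"
  using x
proof (induction t arbitrary: x)
  case 0
  have "(\<Sum>\<tau>\<in>carrier G. P \<sigma> 0 \<tau> * x ^ m \<tau>) = x ^ m \<sigma>"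
    by (rule sum_chain_dist_0[OF finite_carrier_G \<sigma>])
  then show ?case by simp
next
  case (Suc t)
  let ?x = "1 - s * (1 - x)"
  have "s * (1 - x) \<le> 1 * 1" using s_bounds Suc.prems by (intro mult_mono) simp_all
  moreover have "0 \<le> s * (1 - x)" using s_bounds Suc.prems by (intro mult_nonneg_nonneg) simp_all
  ultimately have x': "0 \<le> ?x" "?x \<le> 1" by linarith+
  have "s ^ Suc t * (1 - x) = s ^ t * (1 - ?x)" by simp
  then have "(1 - s ^ Suc t * (1 - x)) ^ m \<sigma> - real (Suc t) * \<delta> =
      ((1 - s ^ t * (1 - ?x)) ^ m \<sigma> - real t * \<delta>) - \<delta>"
    by (simp only: of_nat_Suc distrib_right mult_1 diff_diff_eq add.commute)
  also have "\<dots> \<le> (\<Sum>z\<in>carrier G. P \<sigma> t z * ?x ^ m z) - \<delta>"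
    by (rule diff_right_mono[OF Suc.IH[OF x']])
  also have "\<dots> = (\<Sum>z\<in>carrier G. P \<sigma> t z * (?x ^ m z - \<delta>))"
  proof -
    have "(\<Sum>z\<in>carrier G. P \<sigma> t z * \<delta>) = \<delta>"
      using sum_chain_dist[OF finite_carrier_G \<sigma> burnside_kernel_row_sum[OF G_facts]]
      by (simp only: sum_distrib_right[symmetric] mult_1)
    then show ?thesis by (simp only: right_diff_distrib sum_subtractf)
  qed
  also have "\<dots> \<le> (\<Sum>z\<in>carrier G. P \<sigma> t z * (\<Sum>\<tau>\<in>carrier G. K z \<tau> * x ^ m \<tau>))"
    using kernel_power_ge Suc.prems by (intro sum_mono mult_left_mono P_nonneg) (simp_all add: carrier_G)
  also have "\<dots> = (\<Sum>\<tau>\<in>carrier G. P \<sigma> (Suc t) \<tau> * x ^ m \<tau>)"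
    by (rule sum_chain_dist_Suc[symmetric])
  finally show ?case .
qed

text \<open>Only the term of the identity pair is kept: it is chosen with probability
  \<open>(1 / real p) ^ m \<sigma>\<close>, and then \<open>\<tau>\<close> is uniform.\<close>

lemma kernel_ge_uniform:
  assumes \<sigma>: "\<sigma> \<in> carrier G" and \<tau>: "\<tau> \<in> carrier G"
  shows "(1 / real p) ^ m \<sigma> / real (card (carrier G)) \<le> K \<sigma> \<tau>"
proof -
  let ?I = "invariants (carrier G) (two_sided_act G)"
  have \<sigma>': "\<sigma> permutes \<Omega>" using \<sigma> by (simp add: carrier_G)
  have one: "(id, id) \<in> act_stabilizer G H \<sigma> \<inter> act_stabilizer G H \<tau>"
    using one_act_stabilizer[OF G_facts \<sigma>] one_act_stabilizer[OF G_facts \<tau>]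
    by (simp add: sym_group_one)
  have "?I (id, id) = carrier G"
    by (auto simp: invariants_G[OF H_id] conj_set_def carrier_G)
  moreover have "1 / real (card (?I (id, id))) \<le>
      (\<Sum>hg\<in>act_stabilizer G H \<sigma> \<inter> act_stabilizer G H \<tau>. 1 / real (card (?I hg)))"
    by (rule member_le_sum[OF one]) (simp_all add: finite_act_stabilizer[OF G_facts])
  ultimately have "1 / real (card (act_stabilizer G H \<sigma>)) * (1 / real (card (carrier G))) \<le> K \<sigma> \<tau>"
    unfolding burnside_kernel_def by (intro mult_left_mono) simp_all
  then show ?thesis by (simp add: card_act_stabilizer[OF \<sigma>'] power_one_over)
qed

section \<open>The stationary distribution and the distance to it\<close>

context
  fixes \<pi> :: "(nat \<Rightarrow> nat) \<Rightarrow> real"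
  assumes stat: "stationary_distribution (carrier G) K \<pi>"
begin

lemma stat_nonneg: "\<tau> \<in> carrier G \<Longrightarrow> 0 \<le> \<pi> \<tau>"
  and stat_sum: "(\<Sum>\<tau>\<in>carrier G. \<pi> \<tau>) = 1"
  and stat_eq: "\<tau> \<in> carrier G \<Longrightarrow> (\<Sum>\<sigma>\<in>carrier G. \<pi> \<sigma> * K \<sigma> \<tau>) = \<pi> \<tau>"
  using stat by (simp_all add: stationary_distribution_def)

text \<open>One stationary step bounds the mean by \<open>s\<close> times itself plus
  \<open>\<delta>\<close>, and \<open>1 - s = 1 / real p\<close>.\<close>

lemma stat_mean_le: "(\<Sum>\<tau>\<in>carrier G. \<pi> \<tau> * real (m \<tau>)) \<le> real p * \<delta>"
proof -
  let ?M = "\<Sum>\<tau>\<in>carrier G. \<pi> \<tau> * real (m \<tau>)"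
  have "?M = (\<Sum>\<tau>\<in>carrier G. \<Sum>\<sigma>\<in>carrier G. \<pi> \<sigma> * (K \<sigma> \<tau> * real (m \<tau>)))"
    by (rule sum.cong[OF refl])
      (simp add: stat_eq[symmetric] sum_distrib_right mult.assoc del: stat_eq)
  also have "\<dots> = (\<Sum>\<sigma>\<in>carrier G. \<Sum>\<tau>\<in>carrier G. \<pi> \<sigma> * (K \<sigma> \<tau> * real (m \<tau>)))"
    by (rule sum.swap)
  also have "\<dots> = (\<Sum>\<sigma>\<in>carrier G. \<pi> \<sigma> * (\<Sum>\<tau>\<in>carrier G. K \<sigma> \<tau> * real (m \<tau>)))"
    by (simp only: sum_distrib_left)
  also have "\<dots> \<le> (\<Sum>\<sigma>\<in>carrier G. \<pi> \<sigma> * (s * real (m \<sigma>) + \<delta>))"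
    using kernel_mean_le by (intro sum_mono mult_left_mono stat_nonneg) (simp_all add: carrier_G)
  also have "\<dots> = s * ?M + (\<Sum>\<sigma>\<in>carrier G. \<pi> \<sigma>) * \<delta>"
    by (simp only: distrib_left sum.distrib sum_distrib_left sum_distrib_right mult_ac)
  finally have "?M \<le> s * ?M + \<delta>" by (simp add: stat_sum)
  then have "?M / real p \<le> \<delta>" by (simp add: left_diff_distrib)
  then have "?M \<le> \<delta> * real p" using p_gt_1 by (subst (asm) pos_divide_le_eq) simp_all
  then show ?thesis by (simp only: mult.commute)
qed

text \<open>Markov's inequality for the integer-valued \<open>m\<close>.\<close>

lemma stat_nonzero_le:
  "(\<Sum>\<tau>\<in>{\<tau> \<in> carrier G. m \<tau> \<noteq> 0}. \<pi> \<tau>) \<le> real p * \<delta>"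
proof -
  have "(\<Sum>\<tau>\<in>{\<tau> \<in> carrier G. m \<tau> \<noteq> 0}. \<pi> \<tau>) = (\<Sum>\<tau>\<in>carrier G. if m \<tau> \<noteq> 0 then \<pi> \<tau> else 0)"
    by (rule sum.inter_filter[OF finite_carrier_G])
  also have "\<dots> \<le> (\<Sum>\<tau>\<in>carrier G. \<pi> \<tau> * real (m \<tau>))"
  proof (rule sum_mono)
    fix \<tau> assume "\<tau> \<in> carrier G"
    then have "\<pi> \<tau> * 1 \<le> \<pi> \<tau> * real (m \<tau>)" if "m \<tau> \<noteq> 0"
    proof (intro mult_left_mono stat_nonneg)
      show "1 \<le> real (m \<tau>)" using that by linarith
    qed
    then show "(if m \<tau> \<noteq> 0 then \<pi> \<tau> else 0) \<le> \<pi> \<tau> * real (m \<tau>)" by simp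
  qed
  also note stat_mean_le
  finally show ?thesis .
qed

text \<open>By orbit-stabilizer, \<open>\<pi> \<tau>\<close> is a constant times
  \<open>real p ^ m \<tau>\<close>. It is smallest where \<open>m\<close> vanishes, so its value
  there is at most the average \<open>1 / real (card (carrier G))\<close>.\<close>

lemma stat_formula:
  obtains c where "0 \<le> c" "c \<le> 1 / real (card (carrier G))"
    "\<And>\<tau>. \<tau> \<in> carrier G \<Longrightarrow> m \<tau> = 0 \<Longrightarrow> \<pi> \<tau> = c"
proof
  let ?Z = "real (card (double_cosets G H))"
  let ?c = "1 / (?Z * real (card H * card H))"
  have pi: "\<pi> \<tau> = ?c * real p ^ m \<tau>" if \<tau>: "\<tau> \<in> carrier G" for \<tau>
  proof -
    have \<tau>': "\<tau> permutes \<Omega>" using \<tau> by (simp add: carrier_G)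
    have "real (card H * card H) = real (card (double_coset G H \<tau>)) * real p ^ m \<tau>"
      using orbit_stabilizer_card[OF G_facts \<tau>] card_act_stabilizer[OF \<tau>']
      by (metis of_nat_mult of_nat_power)
    moreover have "\<pi> \<tau> = 1 / (?Z * real (card (double_coset G H \<tau>)))"
      using stat burnside_stationary_iff[OF G_facts] \<tau> by blast
    moreover have "1 / (z * d) = 1 / (z * (d * y)) * y" if "y \<noteq> 0" for z d y :: real
      using that by simp
    moreover have "real p ^ m \<tau> \<noteq> 0" using p_gt_1 by simp
    ultimately show ?thesis by metis
  qed
  show c0: "0 \<le> ?c" by simp
  show "\<pi> \<tau> = ?c" if "\<tau> \<in> carrier G" "m \<tau> = 0" for \<tau>
    using pi[OF that(1)] that(2) by simp
  have "real (card (carrier G)) * ?c = (\<Sum>\<tau>\<in>carrier G. ?c * 1)" by simp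
  also have "\<dots> \<le> (\<Sum>\<tau>\<in>carrier G. ?c * real p ^ m \<tau>)"
    using p_gt_1 by (intro sum_mono mult_left_mono c0) simp
  also have "\<dots> = 1" using stat_sum by (simp only: pi cong: sum.cong)
  finally have "real (card (carrier G)) * ?c \<le> 1" .
  moreover have "0 < real (card (carrier G))"
    using finite_carrier_G carrier_G[of id] permutes_id by (auto simp: card_gt_0_iff)
  ultimately show "?c \<le> 1 / real (card (carrier G))"
    by (simp only: pos_le_divide_eq mult.commute)
qed

lemma tv_dist_bounds:
  assumes \<sigma>: "\<sigma> \<in> carrier G"
  shows "\<bar>tv_dist (carrier G) (P \<sigma> (Suc t)) \<pi> - 1 + (1 - s ^ Suc t) ^ m \<sigma>\<bar>
    \<le> (real p + real t) * \<delta>"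
proof -
  let ?S = "carrier G"
  let ?Z = "{\<tau> \<in> carrier G. m \<tau> = 0}"
  let ?N = "{\<tau> \<in> carrier G. m \<tau> \<noteq> 0}"
  let ?P = "P \<sigma> (Suc t)"
  let ?min = "\<Sum>\<tau>\<in>?S. min (?P \<tau>) (\<pi> \<tau>)"
  have split: "sum f ?S = sum f ?Z + sum f ?N" for f :: "(nat \<Rightarrow> nat) \<Rightarrow> real"
    using sum.Int_Diff[OF finite_carrier_G, of f ?Z]
    by (simp add: Int_def set_diff_eq conj_commute cong: conj_cong)
  have tv: "tv_dist ?S ?P \<pi> = 1 - ?min"
    by (rule tv_dist_eq_min[OF sum_chain_dist[OF finite_carrier_G \<sigma> burnside_kernel_row_sum[OF G_facts]] stat_sum])
  have "?min = (\<Sum>\<tau>\<in>?Z. min (?P \<tau>) (\<pi> \<tau>)) + (\<Sum>\<tau>\<in>?N. min (?P \<tau>) (\<pi> \<tau>))"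
    by (rule split)
  \<comment> \<open>The minimum is bounded by the chain where \<open>m\<close> vanishes and by
    \<open>\<pi>\<close> elsewhere.\<close>
  also have "\<dots> \<le> (\<Sum>\<tau>\<in>?Z. ?P \<tau>) + (\<Sum>\<tau>\<in>?N. \<pi> \<tau>)"
    by (intro add_mono sum_mono) (simp_all only: min.cobounded1 min.cobounded2)
  \<comment> \<open>As \<open>0 ^ 0 = 1\<close>, the power of 0 is the indicator of
    \<open>m \<tau> = 0\<close>.\<close>
  also have "(\<Sum>\<tau>\<in>?Z. ?P \<tau>) = (\<Sum>\<tau>\<in>?S. ?P \<tau> * 0 ^ m \<tau>)"
    by (simp add: sum.inter_filter[OF finite_carrier_G] power_0_left if_distrib del: chain_dist.simps cong: if_cong)
  also have "\<dots> \<le> (1 - s ^ Suc t * (1 - 0)) ^ m \<sigma>"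
    by (rule chain_power_le[OF \<sigma>]) simp_all
  finally have upper: "?min \<le> (1 - s ^ Suc t) ^ m \<sigma> + real p * \<delta>"
    using stat_nonzero_le by simp
  \<comment> \<open>\<open>X\<close> is the probability that step \<open>Suc t\<close> picks the
    identity. The estimate for \<open>t\<close> steps at \<open>1 / real p\<close> contributes the
    last factor \<open>s\<close>, so only \<open>t\<close> errors \<open>\<delta>\<close>
    arise.\<close>
  define X where "X = (\<Sum>z\<in>?S. P \<sigma> t z * (1 / real p) ^ m z)"
  have x: "0 \<le> 1 / real p" "1 / real p \<le> 1" using p_gt_1 by simp_all
  have X0: "0 \<le> X" unfolding X_def by (intro sum_nonneg mult_nonneg_nonneg P_nonneg) (use x in simp_all)
  have "X \<le> (1 - s ^ t * s) ^ m \<sigma>"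
    unfolding X_def using chain_power_le[OF \<sigma> x, of t] .
  also have "\<dots> \<le> 1"
    using s_bounds by (intro power_le_one) (simp_all add: power_le_one mult_le_one)
  finally have X1: "X \<le> 1" .
  have Xge: "(1 - s ^ Suc t) ^ m \<sigma> - real t * \<delta> \<le> X"
    using chain_power_ge[OF \<sigma> x, of t] by (simp add: X_def mult.commute)
  obtain c where c: "0 \<le> c" "c \<le> 1 / real (card (carrier G))"
    "\<And>\<tau>. \<tau> \<in> carrier G \<Longrightarrow> m \<tau> = 0 \<Longrightarrow> \<pi> \<tau> = c"
    using stat_formula by blast
  have P_ge: "X / real (card ?S) \<le> ?P \<tau>" if \<tau>: "\<tau> \<in> ?S" for \<tau>
  proof -
    have "X / real (card ?S) = (\<Sum>z\<in>?S. P \<sigma> t z * ((1 / real p) ^ m z / real (card ?S)))"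
      by (simp add: X_def sum_divide_distrib)
    also have "\<dots> \<le> (\<Sum>z\<in>?S. P \<sigma> t z * K z \<tau>)"
      using kernel_ge_uniform[OF _ \<tau>] by (intro sum_mono mult_left_mono P_nonneg)
    finally show ?thesis by simp
  qed
  \<comment> \<open>Both the chain and \<open>\<pi>\<close> dominate \<open>X * c\<close> here: the
    chain has density at least \<open>X\<close> times uniform, and \<open>X \<le> 1\<close>.\<close>
  have "X * \<pi> \<tau> \<le> min (?P \<tau>) (\<pi> \<tau>)" if \<tau>: "\<tau> \<in> ?Z" for \<tau>
  proof -
    have "\<pi> \<tau> = c" "\<tau> \<in> ?S" using c(3) \<tau> by auto
    moreover have "X * c \<le> ?P \<tau>"
      using mult_left_mono[OF c(2) X0] P_ge[OF \<open>\<tau> \<in> ?S\<close>] by simp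
    moreover have "X * c \<le> 1 * c" by (rule mult_right_mono[OF X1 c(1)])
    ultimately show ?thesis by simp
  qed
  then have "X * (\<Sum>\<tau>\<in>?Z. \<pi> \<tau>) \<le> (\<Sum>\<tau>\<in>?Z. min (?P \<tau>) (\<pi> \<tau>))"
    by (simp only: sum_distrib_left sum_mono)
  moreover have "0 \<le> (\<Sum>\<tau>\<in>?N. min (?P \<tau>) (\<pi> \<tau>))"
    by (rule sum_nonneg) (use P_nonneg stat_nonneg in \<open>auto simp del: chain_dist.simps\<close>)
  ultimately have "X * (\<Sum>\<tau>\<in>?Z. \<pi> \<tau>) \<le> ?min" by (simp only: split[of "\<lambda>\<tau>. min (?P \<tau>) (\<pi> \<tau>)"])
  moreover have "(\<Sum>\<tau>\<in>?Z. \<pi> \<tau>) = 1 - (\<Sum>\<tau>\<in>?N. \<pi> \<tau>)" using split[of \<pi>] stat_sum by simp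
  moreover have "X * (\<Sum>\<tau>\<in>?N. \<pi> \<tau>) \<le> 1 * (\<Sum>\<tau>\<in>?N. \<pi> \<tau>)"
    by (rule mult_right_mono[OF X1 sum_nonneg]) (use stat_nonneg in simp)
  ultimately have "X - (\<Sum>\<tau>\<in>?N. \<pi> \<tau>) \<le> ?min" by (simp add: right_diff_distrib)
  then have lower: "(1 - s ^ Suc t) ^ m \<sigma> - real t * \<delta> - real p * \<delta> \<le> ?min"
    using Xge stat_nonzero_le by linarith
  have "0 \<le> real t * \<delta>" by simp
  then show ?thesis
    unfolding tv distrib_right abs_le_iff using upper lower by linarith
qed

end

end

section \<open>From Sylow subgroups and double coset sizes to numbers of shared blocks\<close>

theorem theorem1p3:
  fixes p k a t :: nat
    and H :: "(nat \<Rightarrow> nat) set"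
    and \<sigma> :: "nat \<Rightarrow> nat"
    and \<pi> :: "(nat \<Rightarrow> nat) \<Rightarrow> real"
  assumes "prime p" and "11 \<le> p" and "1 \<le> k" and "k < p"
    and "sylow_subgroup p H (sym_group (p * k))"
    and "\<sigma> \<in> carrier (sym_group (p * k))"
    and "stationary_distribution (carrier (sym_group (p * k)))
           (burnside_kernel (sym_group (p * k)) H) \<pi>"
    and "card (double_coset (sym_group (p * k)) H \<sigma>) = p ^ a"
    and "1 \<le> t"
  shows "\<bar>tv_dist (carrier (sym_group (p * k)))
              (chain_dist (carrier (sym_group (p * k)))
                 (burnside_kernel (sym_group (p * k)) H) \<sigma> t) \<pi>
            - 1 + (1 - (1 - 1 / real p) ^ t) ^ (2 * k - a)\<bar>
           \<le> 4 * real p ^ 4 / fact (p - 1) + real t / fact (p - 2)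
         \<and> tv_dist (carrier (sym_group (p * k)))
              (chain_dist (carrier (sym_group (p * k)))
                 (burnside_kernel (sym_group (p * k)) H) \<sigma> t) \<pi>
           \<le> 1 - (1 - (1 - 1 / real p) ^ t) ^ (2 * k - a)
             + 4 * real p ^ 4 / fact (p - 1) + real t / fact (p - 2)"
proof -
  have p1: "1 < p" using assms(1) by (rule prime_gt_1_nat)
  have "multiplicity p (order (sym_group (p * k))) = p * k div p"
  proof -
    have "order (sym_group (p * k)) = fact (p * k)"
      by (simp add: order_def sym_group_card_carrier)
    moreover have "p * k < p * p" using assms(4) p1 by simp
    ultimately show ?thesis using multiplicity_fact_less_square[OF assms(1)] by simp
  qed
  then have card_H: "card H = p ^ k"
    using assms(5) p1 by (simp add: sylow_subgroup_def)
  interpret sylow_perm_group p k H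
    by (rule sylow_perm_group.intro) (use assms card_H in \<open>simp_all add: sylow_subgroup_def\<close>)
  have "\<sigma> permutes \<Omega>" using assms(6) by (simp only: carrier_G)
  \<comment> \<open>Orbit-stabilizer identifies the exponent \<open>2 * k - a\<close> with the
    number of shared blocks.\<close>
  then have "p ^ a * p ^ card (shared \<sigma>) = p ^ k * p ^ k"
    using orbit_stabilizer_card[OF G_facts assms(6)] card_act_stabilizer assms(8) card_H by simp
  then have "p ^ (a + card (shared \<sigma>)) = p ^ (k + k)" by (simp only: power_add)
  then have "a + card (shared \<sigma>) = k + k" using p1 by simp
  then have exponent: "2 * k - a = card (shared \<sigma>)" by simp
  obtain t' where t': "t = Suc t'" using assms(9) by (cases t) simp_all
  \<comment> \<open>The stationary error \<open>p / fact (p - 2)\<close> fits into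
    \<open>4 * p ^ 4 / fact (p - 1)\<close> with room to spare, as
    \<open>p * (p - 1) \<le> p ^ 4\<close>.\<close>
  have "real p \<le> 4 * real p ^ 4 / real (p - 1)"
  proof -
    have "real p * real (p - 1) \<le> real p * real p" by (intro mult_left_mono) simp_all
    also have "\<dots> = real p ^ 2" by (simp add: power2_eq_square)
    also have "\<dots> \<le> real p ^ 4" using p1 by (intro power_increasing) simp_all
    also have "\<dots> \<le> 4 * real p ^ 4" by simp
    finally show ?thesis using p1 by (simp add: pos_le_divide_eq)
  qed
  then have "real p / fact (p - 2) \<le> 4 * real p ^ 4 / real (p - 1) / fact (p - 2)"
    by (rule divide_right_mono) simp
  also have "\<dots> = 4 * real p ^ 4 / fact (p - 1)"
  proof -
    have "fact (p - 1) = real (p - 1) * fact (p - 1 - 1)"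
      by (rule fact_reduce) (use p1 in simp)
    moreover have "p - 1 - 1 = p - 2" by simp
    ultimately have "fact (p - 1) = real (p - 1) * fact (p - 2)" by (simp only:)
    then show ?thesis by simp
  qed
  finally have "(real p + real t') * (1 / fact (p - 2))
      \<le> 4 * real p ^ 4 / fact (p - 1) + real t / fact (p - 2)"
    unfolding t' by (simp add: add_divide_distrib add_mono divide_right_mono)
  then have "\<bar>tv_dist (carrier (sym_group (p * k)))
              (chain_dist (carrier (sym_group (p * k)))
                 (burnside_kernel (sym_group (p * k)) H) \<sigma> t) \<pi>
            - 1 + (1 - (1 - 1 / real p) ^ t) ^ (2 * k - a)\<bar>
           \<le> 4 * real p ^ 4 / fact (p - 1) + real t / fact (p - 2)"
    using tv_dist_bounds[OF assms(7,6), of t'] unfolding exponent t' by (rule order.trans[rotated])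
  then show ?thesis unfolding abs_le_iff by linarith
qed

end
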